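(* Let $d\ge 2$ and $t\ge 2$ be fixed integers. For any non-degenerate quadratic form $Q$ on $\mathbb{F}_q^d$ and any set $\mathcal{E} \subset S^d(Q)$, consider the system of $\binom{t}{2}$ equations $$Q(\boldsymbol{a}_i - \boldsymbol{a}_j) = \lambda_{ij}\quad(1\le i<j\le t), \qquad \boldsymbol{a}_i \in \mathcal{E},\ i=1,\ldots,t.$$ If $|\mathcal{E}| \gg q^{(d+t-2)/2}$, then this system is solvable for at least $(1-o(1)) q^{\binom{t}{2}}$ possible choices of $(\lambda_{ij})_{1\le i<j\le t}$ with $\lambda_{ij} \in \mathbb{F}_q$.
   Context: $q$ is a power of an odd prime, viewed as an asymptotic parameter: $q\to\infty$, the set $\mathcal{E}$ and the form $Q$ may depend on $q$, and $o(1)$ denotes a quantity tending to $0$ as $q\to\infty$. $X \ll Y$ (equivalently $Y \gg X$) means $X = o(Y)$. The $Q$-sphere is $S^d(Q) = \{\boldsymbol{x}\in\mathbb{F}_q^d : Q(\boldsymbol{x}) = 1\}$. *)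

theory Defs
  imports "HOL-Algebra.Algebra" "HOL-Library.Landau_Symbols" "HOL-Library.FuncSet"
    "HOL-Number_Theory.Prime_Powers"
begin

text \<open>
  Fields are explicit carriers, so that a single statement can speak about a sequence of finite
  fields whose orders tend to infinity.  The coordinate space \<open>F\<^sup>d\<close> consists of the extensional
  functions on \<open>{..<d}\<close>, so that it has exactly \<open>q\<^sup>d\<close> elements.
\<close>

definition coord_space :: "('a, 'b) ring_scheme \<Rightarrow> nat \<Rightarrow> (nat \<Rightarrow> 'a) set" where
  "coord_space F d = {..<d} \<rightarrow>\<^sub>E carrier F"

definition vec_zero :: "('a, 'b) ring_scheme \<Rightarrow> nat \<Rightarrow> nat \<Rightarrow> 'a" where
  "vec_zero F d = (\<lambda>k\<in>{..<d}. \<zero>\<^bsub>F\<^esub>)"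

definition vec_add :: "('a, 'b) ring_scheme \<Rightarrow> nat \<Rightarrow> (nat \<Rightarrow> 'a) \<Rightarrow> (nat \<Rightarrow> 'a) \<Rightarrow> nat \<Rightarrow> 'a" where
  "vec_add F d x y = (\<lambda>k\<in>{..<d}. x k \<oplus>\<^bsub>F\<^esub> y k)"

definition vec_diff :: "('a, 'b) ring_scheme \<Rightarrow> nat \<Rightarrow> (nat \<Rightarrow> 'a) \<Rightarrow> (nat \<Rightarrow> 'a) \<Rightarrow> nat \<Rightarrow> 'a" where
  "vec_diff F d x y = (\<lambda>k\<in>{..<d}. x k \<ominus>\<^bsub>F\<^esub> y k)"

definition quadratic_form ::
    "('a, 'b) ring_scheme \<Rightarrow> nat \<Rightarrow> ((nat \<Rightarrow> 'a) \<Rightarrow> 'a) \<Rightarrow> bool" where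
  "quadratic_form F d Q \<longleftrightarrow>
     (\<exists>c. (\<forall>i<d. \<forall>j<d. c i j \<in> carrier F) \<and>
        (\<forall>x\<in>coord_space F d.
           Q x = (\<Oplus>\<^bsub>F\<^esub>i\<in>{..<d}. \<Oplus>\<^bsub>F\<^esub>j\<in>{..<d}. c i j \<otimes>\<^bsub>F\<^esub> x i \<otimes>\<^bsub>F\<^esub> x j)))"

definition polar_form ::
    "('a, 'b) ring_scheme \<Rightarrow> nat \<Rightarrow> ((nat \<Rightarrow> 'a) \<Rightarrow> 'a) \<Rightarrow> (nat \<Rightarrow> 'a) \<Rightarrow> (nat \<Rightarrow> 'a) \<Rightarrow> 'a" where
  "polar_form F d Q x y = Q (vec_add F d x y) \<ominus>\<^bsub>F\<^esub> Q x \<ominus>\<^bsub>F\<^esub> Q y"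

text \<open>
  Non-degeneracy is triviality of the radical of the polar form.  The polar form is twice the
  symmetric bilinear form of \<open>Q\<close>, which makes no difference in odd characteristic.
\<close>

definition nondegenerate_quadratic_form ::
    "('a, 'b) ring_scheme \<Rightarrow> nat \<Rightarrow> ((nat \<Rightarrow> 'a) \<Rightarrow> 'a) \<Rightarrow> bool" where
  "nondegenerate_quadratic_form F d Q \<longleftrightarrow>
     quadratic_form F d Q \<and>
     (\<forall>x\<in>coord_space F d.
        (\<forall>y\<in>coord_space F d. polar_form F d Q x y = \<zero>\<^bsub>F\<^esub>) \<longrightarrow> x = vec_zero F d)"

definition Q_sphere ::
    "('a, 'b) ring_scheme \<Rightarrow> nat \<Rightarrow> ((nat \<Rightarrow> 'a) \<Rightarrow> 'a) \<Rightarrow> (nat \<Rightarrow> 'a) set" where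
  "Q_sphere F d Q = {x \<in> coord_space F d. Q x = \<one>\<^bsub>F\<^esub>}"

definition index_pairs :: "nat \<Rightarrow> (nat \<times> nat) set" where
  "index_pairs t = {(i, j). 1 \<le> i \<and> i < j \<and> j \<le> t}"

definition solvable_system ::
    "('a, 'b) ring_scheme \<Rightarrow> nat \<Rightarrow> nat \<Rightarrow> ((nat \<Rightarrow> 'a) \<Rightarrow> 'a) \<Rightarrow> (nat \<Rightarrow> 'a) set
       \<Rightarrow> (nat \<times> nat \<Rightarrow> 'a) \<Rightarrow> bool" where
  "solvable_system F d t Q E l \<longleftrightarrow>
     (\<exists>a. (\<forall>i\<in>{1..t}. a i \<in> E) \<and>
        (\<forall>(i, j)\<in>index_pairs t. Q (vec_diff F d (a i) (a j)) = l (i, j)))"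

definition solvable_choices ::
    "('a, 'b) ring_scheme \<Rightarrow> nat \<Rightarrow> nat \<Rightarrow> ((nat \<Rightarrow> 'a) \<Rightarrow> 'a) \<Rightarrow> (nat \<Rightarrow> 'a) set
       \<Rightarrow> (nat \<times> nat \<Rightarrow> 'a) set" where
  "solvable_choices F d t Q E =
     {l \<in> index_pairs t \<rightarrow>\<^sub>E carrier F. solvable_system F d t Q E l}"

end

theory Submission
  imports Defs
begin

text \<open>
  On the sphere the polar form $B$ of $Q$ satisfies $Q(a-b) = 2 - B(a,b)$, so the question is which
  off-diagonal Gram matrices $(B(a_i,a_j))_{i<j}$ occur for points $a_i$ of $\mathcal{E}$.  They
  are found by fixing one vertex at a time.

  If $x$ is fixed as a vertex and its inner products $\nu_i$ with the other vertices are
  prescribed, the other vertices have to be found in the hyperplane sections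
  $\{y \in \mathcal{E} : B(x,y) = \nu_i\}$.  For most $\nu_i$ such a section has at least
  $|\mathcal{E}|/2q$ points, provided that $x$ is chosen well.  Projected to $x^\perp$, it lies on
  a sphere again, in a non-degenerate space of dimension $d-1$; the radius is non-zero for all but
  at most two values of $\nu_i$, and the remaining inner products change by constants that depend
  on $\nu$ only.  So the problem with parameters
  $(d,\,t,\,|\mathcal{E}|)$ reduces to the same problem with $(d-1,\,t-1,\,|\mathcal{E}|/2q)$,
  and the condition $|\mathcal{E}| \gg q^{(d+t-2)/2}$ reproduces itself.  Since different
  vertices get different sections, the induction (\<open>card_attained_ge\<close>) is about $t$ sets on
  spheres of arbitrary non-zero radii.

  That good $x$ exist is a second moment argument (\<open>sum_discrepancy_sphere\<close>).  The average
  deviation of $|S \cap \{B(x,y)=c\}|$ from $|S|/q$ is computed over all $x$ of the space by double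
  counting.  It is invariant under scaling of $x$, and a sphere of non-zero radius meets every line
  through the origin at most twice, so a set $P$ on such a sphere receives at most $2/(q-1)$ of the
  total.  Hence there are on average at most $8q\,|V|/(|P||S|)$ values $c$ with
  $|S \cap \{B(x,y)=c\}| < |S|/2q$ for $x \in P$, which is a vanishing proportion of all values as
  soon as $|P||S|$ is much larger than $|V|$.

  The final bound is explicit: with $K = |\mathcal{E}|^2/q^{d+t-2}$ the proportion of unsolvable
  choices is at most $C_t\,(1/K + 1/q)$.
\<close>

section \<open>Bilinear forms over finite fields\<close>

text \<open>
  Finite modules over a finite field stand for vector spaces of arbitrary finite dimension.
  Non-degeneracy is a property of a subspace and not of the whole space, because the induction
  below descends to orthogonal complements inside one fixed ambient space.
\<close>

locale finite_bilinear_space = module R M + field R for R (structure) and M (structure) +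
  fixes B :: "'c \<Rightarrow> 'c \<Rightarrow> 'a"
  assumes finite_scalars: "finite (carrier R)"
    and finite_vectors: "finite (carrier M)"
    and form_closed [simp]: "x \<in> carrier M \<Longrightarrow> y \<in> carrier M \<Longrightarrow> B x y \<in> carrier R"
    and form_sym: "x \<in> carrier M \<Longrightarrow> y \<in> carrier M \<Longrightarrow> B x y = B y x"
    and form_add_left: "x \<in> carrier M \<Longrightarrow> y \<in> carrier M \<Longrightarrow> z \<in> carrier M \<Longrightarrow>
      B (x \<oplus>\<^bsub>M\<^esub> y) z = B x z \<oplus> B y z"
    and form_smult_left: "a \<in> carrier R \<Longrightarrow> x \<in> carrier M \<Longrightarrow> z \<in> carrier M \<Longrightarrow>
      B (a \<odot>\<^bsub>M\<^esub> x) z = a \<otimes> B x z"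
begin

abbreviation q :: nat where "q \<equiv> card (carrier R)"

definition nondegenerate_subspace :: "'c set \<Rightarrow> bool" where
  "nondegenerate_subspace V \<longleftrightarrow>
     submodule V R M \<and> (\<forall>z\<in>V. (\<forall>u\<in>V. B u z = \<zero>) \<longrightarrow> z = \<zero>\<^bsub>M\<^esub>)"

definition slice :: "'c set \<Rightarrow> 'c \<Rightarrow> 'a \<Rightarrow> 'c set" where
  "slice S x c = {y \<in> S. B x y = c}"

text \<open>
  For an equidistributed set $S$, each of the $q$ hyperplanes $\{y : B(x,y) = c\}$ would contain
  $|S|/q$ points.  The discrepancy is $q$ times the variance of the actual counts; half of the
  expected number is the threshold for thin values.
\<close>

definition discrepancy :: "'c set \<Rightarrow> 'c \<Rightarrow> real" where
  "discrepancy S x = (\<Sum>c\<in>carrier R. (real (card (slice S x c)) - real (card S) / real q)\<^sup>2)"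

definition thin_values :: "'c set \<Rightarrow> 'c \<Rightarrow> 'a set" where
  "thin_values S x = {c \<in> carrier R. 2 * q * card (slice S x c) < card S}"

lemma q_ge_2: "2 \<le> q"
proof -
  have "card {\<zero>, \<one>} \<le> q"
    by (rule card_mono) (auto simp: finite_scalars)
  then show ?thesis by simp
qed

lemma form_add_right: "x \<in> carrier M \<Longrightarrow> y \<in> carrier M \<Longrightarrow> z \<in> carrier M \<Longrightarrow>
    B z (x \<oplus>\<^bsub>M\<^esub> y) = B z x \<oplus> B z y"
  using form_add_left[of x y z] by (simp add: form_sym)

lemma form_smult_right: "a \<in> carrier R \<Longrightarrow> x \<in> carrier M \<Longrightarrow> z \<in> carrier M \<Longrightarrow>
    B z (a \<odot>\<^bsub>M\<^esub> x) = a \<otimes> B z x"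
  using form_smult_left[of a x z] by (simp add: form_sym)

lemma form_minus_right: "x \<in> carrier M \<Longrightarrow> z \<in> carrier M \<Longrightarrow> B z (\<ominus>\<^bsub>M\<^esub> x) = \<ominus> B z x"
  by (metis M.a_inv_closed M.r_neg R.minus_equality form_add_right form_closed form_smult_right
      smult_l_null R.zero_closed M.zero_closed R.add.m_comm R.l_null)

lemma form_minus_left: "x \<in> carrier M \<Longrightarrow> z \<in> carrier M \<Longrightarrow> B (\<ominus>\<^bsub>M\<^esub> x) z = \<ominus> B x z"
  using form_minus_right[of x z] by (simp add: form_sym)

lemma nondegenerate_subspaceD:
  assumes "nondegenerate_subspace V"
  shows "V \<subseteq> carrier M" "finite V" "\<zero>\<^bsub>M\<^esub> \<in> V"
    "x \<in> V \<Longrightarrow> y \<in> V \<Longrightarrow> x \<oplus>\<^bsub>M\<^esub> y \<in> V"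
    "x \<in> V \<Longrightarrow> \<ominus>\<^bsub>M\<^esub> x \<in> V"
    "a \<in> carrier R \<Longrightarrow> x \<in> V \<Longrightarrow> a \<odot>\<^bsub>M\<^esub> x \<in> V"
proof -
  have s: "submodule V R M" using assms by (simp add: nondegenerate_subspace_def)
  note e = submoduleE[OF s]
  show "V \<subseteq> carrier M" by (rule e)
  then show "finite V" using finite_vectors finite_subset by blast
  obtain v where v: "v \<in> V" using e(2) by blast
  then have "\<zero> \<odot>\<^bsub>M\<^esub> v \<in> V" using e(4) by blast
  then show "\<zero>\<^bsub>M\<^esub> \<in> V" using v e(1) by (simp add: subset_iff)
  show "x \<in> V \<Longrightarrow> y \<in> V \<Longrightarrow> x \<oplus>\<^bsub>M\<^esub> y \<in> V" by (rule e)
  show "x \<in> V \<Longrightarrow> \<ominus>\<^bsub>M\<^esub> x \<in> V" by (rule e)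
  show "a \<in> carrier R \<Longrightarrow> x \<in> V \<Longrightarrow> a \<odot>\<^bsub>M\<^esub> x \<in> V" by (rule e)
qed

lemma ex_form_eq_one:
  assumes V: "nondegenerate_subspace V" and z: "z \<in> V" "z \<noteq> \<zero>\<^bsub>M\<^esub>"
  obtains u where "u \<in> V" "B z u = \<one>"
proof -
  note D = nondegenerate_subspaceD[OF V]
  obtain u where u: "u \<in> V" "B u z \<noteq> \<zero>"
    using V z by (auto simp: nondegenerate_subspace_def)
  have c: "u \<in> carrier M" "z \<in> carrier M" using D u z by auto
  have U: "B u z \<in> Units R" using u c by (simp add: field_Units)
  have "inv (B u z) \<odot>\<^bsub>M\<^esub> u \<in> V" using U D(6) u by simp
  moreover have "B z (inv (B u z) \<odot>\<^bsub>M\<^esub> u) = \<one>"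
    using U c by (simp add: form_smult_right form_sym[of z u])
  ultimately show ?thesis by (rule that)
qed

text \<open>
  The functional $B(z,\cdot)$ is onto, so it splits: if $B(z,u)=1$, then each vector of $V$ is
  uniquely an element of the kernel plus a multiple of $u$.
\<close>

lemma card_slice_subspace:
  assumes V: "nondegenerate_subspace V" and z: "z \<in> V" "z \<noteq> \<zero>\<^bsub>M\<^esub>"
  shows "card V = q * card (slice V z \<zero>)"
proof -
  note D = nondegenerate_subspaceD[OF V]
  obtain u where u: "u \<in> V" "B z u = \<one>" using ex_form_eq_one[OF V z] .
  have zc: "z \<in> carrier M" and uc: "u \<in> carrier M" using z u D by auto
  define f where "f = (\<lambda>(c, k). k \<oplus>\<^bsub>M\<^esub> c \<odot>\<^bsub>M\<^esub> u)"
  define g where "g = (\<lambda>v. (B z v, v \<oplus>\<^bsub>M\<^esub> \<ominus>\<^bsub>M\<^esub> (B z v \<odot>\<^bsub>M\<^esub> u)))"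
  have "bij_betw f (carrier R \<times> slice V z \<zero>) V"
  proof (rule bij_betw_byWitness[where f' = g])
    show "\<forall>a\<in>carrier R \<times> slice V z \<zero>. g (f a) = a"
      using D(1) u zc uc
      by (auto simp: f_def g_def slice_def form_add_right form_smult_right subset_iff
          M.add.m_assoc M.r_neg)
    show "\<forall>v\<in>V. f (g v) = v"
      using D(1) u zc uc
      by (auto simp: f_def g_def subset_iff M.add.m_assoc M.l_neg)
    show "f ` (carrier R \<times> slice V z \<zero>) \<subseteq> V"
      using D u by (auto simp: f_def slice_def)
    show "g ` V \<subseteq> carrier R \<times> slice V z \<zero>"
      using D u zc uc
      by (auto simp: g_def slice_def form_add_right form_smult_right form_minus_right subset_iff
          R.r_neg)
  qed
  then show ?thesis by (metis bij_betw_same_card card_cartesian_product)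
qed

text \<open>
  A vector orthogonal to $x^\perp$ is orthogonal to the projection $u - (B(x,u)/B(x,x))\,x$ of
  every $u \in V$; being itself orthogonal to $x$, it is orthogonal to $u$.
\<close>

lemma nondegenerate_orthogonal_complement:
  assumes V: "nondegenerate_subspace V" and x: "x \<in> V" "B x x \<noteq> \<zero>"
  shows "nondegenerate_subspace (slice V x \<zero>)"
proof -
  note D = nondegenerate_subspaceD[OF V]
  have xc: "x \<in> carrier M" using x D by auto
  have U: "B x x \<in> Units R" using x xc by (simp add: field_Units)
  have x0: "B x \<zero>\<^bsub>M\<^esub> = \<zero>"
    using form_smult_right[of \<zero> x x] xc by simp
  have sub: "submodule (slice V x \<zero>) R M"
    by (rule submoduleI)
       (use D xc x0 in \<open>auto simp: slice_def form_add_right form_smult_right form_minus_right subset_iff\<close>)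
  moreover have "z = \<zero>\<^bsub>M\<^esub>" if z: "z \<in> slice V x \<zero>" and orth: "\<forall>u\<in>slice V x \<zero>. B u z = \<zero>" for z
  proof -
    have zV: "z \<in> V" and zc: "z \<in> carrier M" and xz: "B x z = \<zero>" using z D by (auto simp: slice_def)
    have "B u z = \<zero>" if u: "u \<in> V" for u
    proof -
      have uc: "u \<in> carrier M" using u D by auto
      define a where "a = \<ominus> (B x u \<otimes> inv (B x x))"
      have a: "a \<in> carrier R" using xc uc U by (simp add: a_def)
      have "B x (u \<oplus>\<^bsub>M\<^esub> a \<odot>\<^bsub>M\<^esub> x) = B x u \<oplus> \<ominus> (B x u \<otimes> inv (B x x)) \<otimes> B x x"
        using a xc uc by (simp add: form_add_right form_smult_right a_def)
      also have "\<dots> = \<zero>"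
        using U xc uc by (simp add: R.l_minus R.m_assoc R.r_neg)
      finally have "u \<oplus>\<^bsub>M\<^esub> a \<odot>\<^bsub>M\<^esub> x \<in> slice V x \<zero>"
        using D u x a by (simp add: slice_def)
      then have "B (u \<oplus>\<^bsub>M\<^esub> a \<odot>\<^bsub>M\<^esub> x) z = \<zero>" using orth by blast
      then show ?thesis using a xc uc zc xz by (simp add: form_add_left form_smult_left)
    qed
    then show ?thesis using V zV by (auto simp: nondegenerate_subspace_def)
  qed
  ultimately show ?thesis by (auto simp: nondegenerate_subspace_def)
qed

section \<open>Equidistribution over hyperplanes\<close>

lemma sum_card_slice:
  assumes "S \<subseteq> carrier M" "x \<in> carrier M"
  shows "(\<Sum>c\<in>carrier R. card (slice S x c)) = card S"
proof -
  have f: "finite S" using assms finite_vectors finite_subset by blast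
  have "(\<Sum>c\<in>carrier R. card (slice S x c)) = card (\<Union>c\<in>carrier R. slice S x c)"
    by (rule card_UN_disjoint[symmetric]) (auto simp: f finite_scalars slice_def)
  also have "(\<Union>c\<in>carrier R. slice S x c) = S" using assms by (auto simp: slice_def subset_iff)
  finally show ?thesis .
qed

lemma sum_card_slice_sq:
  assumes "S \<subseteq> carrier M" "x \<in> carrier M"
  shows "(\<Sum>c\<in>carrier R. card (slice S x c) ^ 2) = card {(y, z). y \<in> S \<and> z \<in> S \<and> B x y = B x z}"
proof -
  have f: "finite S" using assms finite_vectors finite_subset by blast
  have "(\<Sum>c\<in>carrier R. card (slice S x c) ^ 2) = (\<Sum>c\<in>carrier R. card (slice S x c \<times> slice S x c))"
    by (simp add: card_cartesian_product power2_eq_square)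
  also have "\<dots> = card (\<Union>c\<in>carrier R. slice S x c \<times> slice S x c)"
    by (rule card_UN_disjoint[symmetric]) (auto simp: f finite_scalars slice_def)
  also have "(\<Union>c\<in>carrier R. slice S x c \<times> slice S x c) = {(y, z). y \<in> S \<and> z \<in> S \<and> B x y = B x z}"
    using assms by (auto simp: slice_def subset_iff)
  finally show ?thesis .
qed

lemma discrepancy_nonneg: "0 \<le> discrepancy S x"
  by (simp add: discrepancy_def sum_nonneg)

text \<open>
  The second moment of the counts is the number of pairs in $S$ that $B(x,\cdot)$ does not
  separate, which is easy to average over $x$.
\<close>

lemma discrepancy_eq:
  assumes "S \<subseteq> carrier M" "x \<in> carrier M"
  shows "discrepancy S x =
    real (card {(y, z). y \<in> S \<and> z \<in> S \<and> B x y = B x z}) - real (card S)^2 / real q"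
proof -
  have q0: "real q > 0" using q_ge_2 by simp
  have s1: "(\<Sum>c\<in>carrier R. real (card (slice S x c))) = real (card S)"
    by (metis sum_card_slice[OF assms] of_nat_sum)
  have s2: "(\<Sum>c\<in>carrier R. real (card (slice S x c)) ^ 2) =
      real (card {(y, z). y \<in> S \<and> z \<in> S \<and> B x y = B x z})"
    unfolding sum_card_slice_sq[OF assms, symmetric] by simp
  have "discrepancy S x = (\<Sum>c\<in>carrier R. real (card (slice S x c)) ^ 2)
      - 2 * (real (card S) / q) * (\<Sum>c\<in>carrier R. real (card (slice S x c)))
      + real q * (real (card S) / q)\<^sup>2"
    unfolding discrepancy_def
    by (simp add: power2_diff sum.distrib sum_subtractf sum_distrib_left sum_divide_distrib algebra_simps)
  also have "\<dots> = real (card {(y, z). y \<in> S \<and> z \<in> S \<and> B x y = B x z}) - real (card S)^2 / real q"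
    unfolding s1 s2 using q0 by (simp add: field_simps power2_eq_square)
  finally show ?thesis .
qed

text \<open>
  Scaling $x$ only permutes the hyperplanes.  This invariance is what makes points on a sphere
  behave better than arbitrary points.
\<close>

lemma discrepancy_smult:
  assumes "S \<subseteq> carrier M" "x \<in> carrier M" "a \<in> carrier R" "a \<noteq> \<zero>"
  shows "discrepancy S (a \<odot>\<^bsub>M\<^esub> x) = discrepancy S x"
proof -
  have "{(y, z). y \<in> S \<and> z \<in> S \<and> B (a \<odot>\<^bsub>M\<^esub> x) y = B (a \<odot>\<^bsub>M\<^esub> x) z} =
     {(y, z). y \<in> S \<and> z \<in> S \<and> B x y = B x z}"
    using assms by (auto simp: form_smult_left subset_iff m_lcancel)
  then show ?thesis using assms by (simp add: discrepancy_eq)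
qed

text \<open>
  Double counting: a pair $y \neq z$ fails to be separated by exactly the $x$ in the hyperplane
  $(y-z)^\perp$, that is by one $x$ in $q$, while a pair $y = z$ is never separated.
\<close>

lemma sum_discrepancy_subspace:
  assumes V: "nondegenerate_subspace V" and S: "S \<subseteq> V"
  shows "(\<Sum>x\<in>V. discrepancy S x) = real (card S) * real (card V) * (1 - 1 / real q)"
proof -
  note D = nondegenerate_subspaceD[OF V]
  have fS: "finite S" and Sc: "S \<subseteq> carrier M" using S D(1,2) finite_subset by blast+
  have q0: "real q > 0" using q_ge_2 by simp
  have fib: "real (card {x\<in>V. B x y = B x z}) =
      (if y = z then real (card V) else real (card V) / q)" if y: "y \<in> S" and z: "z \<in> S" for y z
  proof (cases "y = z")
    case False
    have yc: "y \<in> carrier M" and zc: "z \<in> carrier M" using y z Sc by auto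
    define w where "w = y \<oplus>\<^bsub>M\<^esub> \<ominus>\<^bsub>M\<^esub> z"
    have "y \<in> V" "z \<in> V" using y z S by auto
    then have w: "w \<in> V" using D(4,5) by (simp add: w_def)
    have "w \<noteq> \<zero>\<^bsub>M\<^esub>"
      using False yc zc M.minus_equality[of y "\<ominus>\<^bsub>M\<^esub> z"] by (auto simp: w_def)
    have wc: "w \<in> carrier M" using w D by auto
    have "{x\<in>V. B x y = B x z} = slice V w \<zero>"
    proof -
      have "B x y = B x z \<longleftrightarrow> B w x = \<zero>" if "x \<in> V" for x
      proof -
        have xc: "x \<in> carrier M" using that D by auto
        have "B w x = B x y \<ominus> B x z"
          unfolding form_sym[OF wc xc] using xc yc zc
          by (simp add: w_def form_add_right form_minus_right R.minus_eq)
        then show ?thesis using xc yc zc by simp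
      qed
      then show ?thesis by (auto simp: slice_def)
    qed
    moreover have "real (card V) = real q * real (card (slice V w \<zero>))"
      using card_slice_subspace[OF V w \<open>w \<noteq> \<zero>\<^bsub>M\<^esub>\<close>] by simp
    ultimately show ?thesis using False q0 by (simp add: field_simps)
  qed simp
  have "(\<Sum>x\<in>V. real (card {(y, z). y \<in> S \<and> z \<in> S \<and> B x y = B x z})) =
      (\<Sum>x\<in>V. \<Sum>(y,z)\<in>S\<times>S. if B x y = B x z then 1 else 0)"
  proof (rule sum.cong[OF refl])
    fix x assume "x \<in> V"
    have "{(y, z). y \<in> S \<and> z \<in> S \<and> B x y = B x z} = {p\<in>S\<times>S. B x (fst p) = B x (snd p)}" by auto
    then show "real (card {(y, z). y \<in> S \<and> z \<in> S \<and> B x y = B x z}) =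
        (\<Sum>(y,z)\<in>S\<times>S. if B x y = B x z then 1 else 0)"
      using fS by (simp add: case_prod_unfold sum.If_cases Int_def)
  qed
  also have "\<dots> = (\<Sum>(y,z)\<in>S\<times>S. \<Sum>x\<in>V. if B x y = B x z then 1 else 0)"
    by (simp add: case_prod_unfold, rule sum.swap)
  also have "\<dots> = (\<Sum>(y,z)\<in>S\<times>S. real (card {x\<in>V. B x y = B x z}))"
    using D(2) by (simp add: sum.If_cases Int_def)
  also have "\<dots> = (\<Sum>(y,z)\<in>S\<times>S. if y = z then real (card V) else real (card V) / q)"
    by (rule sum.cong) (auto simp: fib)
  also have "\<dots> = (\<Sum>(y,z)\<in>S\<times>S. real (card V) / q + (if z = y then real (card V) - real (card V) / q else 0))"
    by (rule sum.cong) auto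
  also have "\<dots> = (\<Sum>y\<in>S. \<Sum>z\<in>S. real (card V) / q + (if z = y then real (card V) - real (card V) / q else 0))"
    by (simp add: sum.cartesian_product)
  also have "\<dots> = real (card S) * (real (card S) * (real (card V) / q) + (real (card V) - real (card V) / q))"
    using fS by (simp add: sum.distrib)
  finally have *: "(\<Sum>x\<in>V. real (card {(y, z). y \<in> S \<and> z \<in> S \<and> B x y = B x z})) =
    real (card S) * (real (card S) * (real (card V) / q) + (real (card V) - real (card V) / q))" .
  have "(\<Sum>x\<in>V. discrepancy S x) =
     (\<Sum>x\<in>V. real (card {(y, z). y \<in> S \<and> z \<in> S \<and> B x y = B x z}) - real (card S)^2 / real q)"
    by (rule sum.cong) (use Sc D in \<open>auto simp: discrepancy_eq subset_iff\<close>)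
  also have "\<dots> = real (card S) * real (card V) * (1 - 1 / real q)"
    unfolding sum_subtractf * using q0 by (simp add: field_simps power2_eq_square)
  finally show ?thesis .
qed

lemma card_square_roots_le:
  assumes "c \<in> carrier R"
  shows "card {s \<in> carrier R. s \<otimes> s = c} \<le> 2"
proof (cases "\<exists>s\<in>carrier R. s \<otimes> s = c")
  case True
  then obtain a where a: "a \<in> carrier R" "a \<otimes> a = c" by blast
  have "{s \<in> carrier R. s \<otimes> s = c} \<subseteq> {a, \<ominus> a}"
  proof
    fix s assume "s \<in> {s \<in> carrier R. s \<otimes> s = c}"
    then have s: "s \<in> carrier R" "s \<otimes> s = a \<otimes> a" using a by auto
    have "(s \<ominus> a) \<otimes> (s \<oplus> a) = s \<otimes> s \<oplus> (s \<otimes> a \<oplus> (\<ominus> (s \<otimes> a) \<oplus> \<ominus> (a \<otimes> a)))"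
      using s(1) a(1)
      by (simp add: R.minus_eq R.l_distr R.r_distr R.l_minus R.m_comm[of a s] R.a_assoc R.add.m_lcomm)
    then have "(s \<ominus> a) \<otimes> (s \<oplus> a) = \<zero>" using s a assms by (simp add: R.r_neg R.r_neg2)
    then have "s \<ominus> a = \<zero> \<or> s \<oplus> a = \<zero>" 
      using s(1) a(1) by (intro integral) simp_all
    then show "s \<in> {a, \<ominus> a}"
      using s(1) a(1) R.minus_equality[of s a] by auto
  qed
  then have "card {s \<in> carrier R. s \<otimes> s = c} \<le> card {a, \<ominus> a}" by (intro card_mono) auto
  also have "\<dots> \<le> 2" by (simp add: card_insert_if)
  finally show ?thesis .
next
  case False
  then have "{s \<in> carrier R. s \<otimes> s = c} = {}" by blast
  then have "card {s \<in> carrier R. s \<otimes> s = c} = 0" by (simp only: card.empty)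
  then show ?thesis by simp
qed

text \<open>
  A line through the origin meets a sphere of non-zero radius in at most two points, since
  $B(sx,sx) = s^2 B(x,x)$.  So the nonzero multiples of the points of $P$ cover $V$ at most twice,
  and by invariance under scaling the sum over $P$ is at most $2/(q-1)$ times the sum over $V$.
  Bounding the sum over $P$ by the sum over $V$ would lose a factor $q$, and with it the exponent
  of the theorem.
\<close>

lemma sum_discrepancy_sphere:
  assumes V: "nondegenerate_subspace V" and S: "S \<subseteq> V" and P: "P \<subseteq> V"
    and r: "r \<noteq> \<zero>" "\<And>x. x \<in> P \<Longrightarrow> B x x = r"
  shows "(\<Sum>x\<in>P. discrepancy S x) \<le> 2 * real (card S) * real (card V) / real q"
proof -
  note D = nondegenerate_subspaceD[OF V]
  have fX: "finite P" and Sc: "S \<subseteq> carrier M" and Xc: "P \<subseteq> carrier M"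
    using S P D(1,2) finite_subset by blast+
  have q1: "real q > 1" using q_ge_2 by simp
  define A where "A = carrier R - {\<zero>}"
  have cA: "real (card A) = real q - 1"
    unfolding A_def using finite_scalars q1 by (simp add: of_nat_diff)
  have fA: "finite A" by (simp add: A_def finite_scalars)
  define f where "f = (\<lambda>(x, s). s \<odot>\<^bsub>M\<^esub> x)"
  have fV: "f ` (P \<times> A) \<subseteq> V" using D(6) P by (auto simp: f_def A_def)
  have fiber: "card {p \<in> P \<times> A. f p = v} \<le> 2" if v: "v \<in> V" for v
  proof (cases "P = {}")
    case False
    have vc: "v \<in> carrier M" using v D by auto
    have rc: "r \<in> carrier R" using False r(2) Xc by (metis ex_in_conv form_closed subsetD)
    have U: "r \<in> Units R" using rc r(1) by (simp add: field_Units)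
    let ?T = "{s \<in> carrier R. s \<otimes> s = B v v \<otimes> inv r}"
    have "inj_on snd {p \<in> P \<times> A. f p = v}"
    proof (rule inj_onI)
      fix p p' assume "p \<in> {p \<in> P \<times> A. f p = v}" "p' \<in> {p \<in> P \<times> A. f p = v}" "snd p = snd p'"
      then obtain x x' s where e: "p = (x, s)" "p' = (x', s)" "x \<in> P" "x' \<in> P" "s \<in> A"
        "s \<odot>\<^bsub>M\<^esub> x = s \<odot>\<^bsub>M\<^esub> x'" by (auto simp: f_def)
      have sU: "s \<in> Units R" using e by (auto simp: A_def field_Units)
      have cancel: "inv s \<odot>\<^bsub>M\<^esub> (s \<odot>\<^bsub>M\<^esub> w) = w" if "w \<in> P" for w
      proof -
        have "inv s \<odot>\<^bsub>M\<^esub> (s \<odot>\<^bsub>M\<^esub> w) = (inv s \<otimes> s) \<odot>\<^bsub>M\<^esub> w"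
          using sU that Xc by (intro smult_assoc1[symmetric]) (simp_all add: subset_iff R.Units_closed)
        then show ?thesis using sU that Xc by (simp add: subset_iff R.Units_l_inv)
      qed
      have "x = x'" using cancel[OF e(3)] cancel[OF e(4)] e(6) by metis
      then show "p = p'" using e by simp
    qed
    moreover have "snd ` {p \<in> P \<times> A. f p = v} \<subseteq> ?T"
    proof
      fix s assume "s \<in> snd ` {p \<in> P \<times> A. f p = v}"
      then obtain x where xs: "x \<in> P" "s \<in> A" "f (x, s) = v" by auto
      have xc: "x \<in> carrier M" and sc: "s \<in> carrier R" using xs Xc by (auto simp: A_def)
      have "B v v = s \<otimes> (s \<otimes> r)"
        using xs xc sc r(2)[OF xs(1)] by (auto simp: f_def form_smult_left form_smult_right)
      then have "B v v \<otimes> inv r = s \<otimes> s"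
        using sc rc U by (simp add: R.m_assoc)
      then show "s \<in> ?T" using sc by simp
    qed
    ultimately have "card {p \<in> P \<times> A. f p = v} \<le> card ?T"
      by (rule card_inj_on_le) (simp add: finite_scalars)
    also have "\<dots> \<le> 2" using U vc by (intro card_square_roots_le) simp
    finally show ?thesis .
  qed simp
  have "(real q - 1) * (\<Sum>x\<in>P. discrepancy S x) = (\<Sum>x\<in>P. \<Sum>s\<in>A. discrepancy S x)"
    by (simp add: cA sum_distrib_left)
  also have "\<dots> = (\<Sum>x\<in>P. \<Sum>s\<in>A. discrepancy S (s \<odot>\<^bsub>M\<^esub> x))"
    using Sc Xc by (intro sum.cong refl discrepancy_smult[symmetric]) (auto simp: A_def)
  also have "\<dots> = (\<Sum>p\<in>P\<times>A. discrepancy S (f p))"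
    by (simp add: sum.cartesian_product f_def case_prod_unfold)
  also have "\<dots> = (\<Sum>v\<in>V. \<Sum>p\<in>{p \<in> P \<times> A. f p = v}. discrepancy S (f p))"
    by (rule sum.group[symmetric]) (use fX fA D(2) fV in auto)
  also have "\<dots> = (\<Sum>v\<in>V. real (card {p \<in> P \<times> A. f p = v}) * discrepancy S v)"
    by (rule sum.cong) auto
  also have "\<dots> \<le> (\<Sum>v\<in>V. 2 * discrepancy S v)"
    using fiber by (intro sum_mono mult_right_mono discrepancy_nonneg) force
  also have "\<dots> = 2 * (real (card S) * real (card V) * (1 - 1 / real q))"
    using sum_discrepancy_subspace[OF V S] by (simp add: sum_distrib_left[symmetric])
  also have "\<dots> = (real q - 1) * (2 * real (card S) * real (card V) / real q)"
    using q1 by (simp add: field_simps)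
  finally show ?thesis by (rule mult_left_le_imp_le) (use q1 in simp)
qed

text \<open>
  Each thin value contributes more than $(|S|/2q)^2$ to the discrepancy.
\<close>

lemma card_thin_values_le:
  assumes "S \<subseteq> carrier M" "x \<in> carrier M"
  shows "real (card (thin_values S x)) * (real (card S))\<^sup>2 \<le> 4 * (real q)\<^sup>2 * discrepancy S x"
proof -
  have q0: "real q > 0" using q_ge_2 by simp
  have "real (card (thin_values S x)) * (real (card S) / (2 * q))\<^sup>2 =
      (\<Sum>c\<in>thin_values S x. (real (card S) / (2 * q))\<^sup>2)" by simp
  also have "\<dots> \<le> (\<Sum>c\<in>thin_values S x. (real (card (slice S x c)) - real (card S) / real q)\<^sup>2)"
  proof (rule sum_mono)
    fix c assume "c \<in> thin_values S x"
    then have "2 * q * card (slice S x c) < card S" by (simp add: thin_values_def)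
    then have "real (2 * q * card (slice S x c)) < real (card S)" by (simp only: of_nat_less_iff)
    then have "real (card (slice S x c)) \<le> real (card S) / (2 * q)" using q0 by (simp add: field_simps)
    then have "real (card S) / (2 * q) \<le> real (card S) / q - real (card (slice S x c))"
      using q0 by (simp add: field_simps)
    then show "(real (card S) / (2 * q))\<^sup>2 \<le> (real (card (slice S x c)) - real (card S) / real q)\<^sup>2"
      by (subst power2_commute) (rule power_mono, auto)
  qed
  also have "\<dots> \<le> discrepancy S x"
    unfolding discrepancy_def
    by (rule sum_mono2) (auto simp: finite_scalars thin_values_def)
  finally show ?thesis using q0 by (simp add: field_simps power2_eq_square)
qed

lemma sum_card_thin_values_le:
  assumes V: "nondegenerate_subspace V" and S: "S \<subseteq> V" "S \<noteq> {}" and P: "P \<subseteq> V"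
    and r: "r \<noteq> \<zero>" "\<And>x. x \<in> P \<Longrightarrow> B x x = r"
  shows "(\<Sum>x\<in>P. real (card (thin_values S x))) \<le> 8 * real q * real (card V) / real (card S)"
proof -
  note D = nondegenerate_subspaceD[OF V]
  have q0: "real q > 0" using q_ge_2 by simp
  have "finite S" using S D(1,2) finite_subset by blast
  then have s0: "real (card S) > 0" using S by (simp add: card_gt_0_iff)
  have "(\<Sum>x\<in>P. real (card (thin_values S x))) * (real (card S))\<^sup>2 
     \<le> (\<Sum>x\<in>P. 4 * (real q)\<^sup>2 * discrepancy S x)"
    unfolding sum_distrib_right using S P D(1) by (intro sum_mono card_thin_values_le) auto
  also have "\<dots> = 4 * (real q)\<^sup>2 * (\<Sum>x\<in>P. discrepancy S x)" by (simp add: sum_distrib_left)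
  also have "\<dots> \<le> 4 * (real q)\<^sup>2 * (2 * real (card S) * real (card V) / real q)"
    using sum_discrepancy_sphere[OF V S(1) P r] by (intro mult_left_mono) auto
  also have "\<dots> = (8 * real q * real (card V) / real (card S)) * (real (card S))\<^sup>2"
    using q0 s0 by (simp add: power2_eq_square)
  finally show ?thesis by (rule mult_right_le_imp_le) (use s0 in simp)
qed

end

section \<open>Gram matrices of points on spheres\<close>

lemma index_pairs_0 [simp]: "index_pairs 0 = {}"
  by (auto simp: index_pairs_def)

lemma index_pairs_Suc: "index_pairs (Suc t) = index_pairs t \<union> (\<lambda>i. (i, Suc t)) ` {1..t}"
  by (auto simp: index_pairs_def)

lemma index_pairs_iff: "(i, j) \<in> index_pairs t \<longleftrightarrow> 1 \<le> i \<and> i < j \<and> j \<le> t"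
  by (simp add: index_pairs_def)

lemma finite_index_pairs [simp]: "finite (index_pairs t)"
  by (rule finite_subset[OF _ finite_cartesian_product[of "{1..t}" "{1..t}"]]) (auto simp: index_pairs_def)

lemma card_index_pairs: "card (index_pairs t) = t choose 2"
proof (induction t)
  case (Suc t)
  have "card (index_pairs (Suc t)) = card (index_pairs t) + card ((\<lambda>i. (i, Suc t)) ` {1..t})"
    unfolding index_pairs_Suc by (rule card_Un_disjoint) (auto simp: index_pairs_iff)
  also have "card ((\<lambda>i. (i, Suc t)) ` {1..t}) = t"
    by (subst card_image) (auto simp: inj_on_def)
  finally show ?case using Suc by (simp add: numeral_2_eq_2)
qed (simp add: binomial_eq_0)

text \<open>
  Weierstrass' product inequality.
\<close>

lemma prod_ge_one_minus_sum:
  fixes f :: "'i \<Rightarrow> real"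
  assumes "finite I" "\<And>i. i \<in> I \<Longrightarrow> 0 \<le> g i" "\<And>i. i \<in> I \<Longrightarrow> 0 \<le> f i" "\<And>i. i \<in> I \<Longrightarrow> 1 - f i \<le> g i" 
    "\<And>i. i \<in> I \<Longrightarrow> g i \<le> 1"
  shows "1 - (\<Sum>i\<in>I. f i) \<le> (\<Prod>i\<in>I. g i)"
  using assms
proof (induction I)
  case (insert a I)
  have p: "0 \<le> prod g I" "prod g I \<le> 1"
    using insert.prems by (auto intro: prod_nonneg prod_le_1)
  have "1 - (f a + sum f I) \<le> prod g I - f a"
    using insert by simp
  also have "\<dots> \<le> prod g I - f a * prod g I"
    using p insert.prems(2)[of a] by (simp add: mult_left_le)
  also have "\<dots> = (1 - f a) * prod g I" by (simp add: algebra_simps)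
  also have "\<dots> \<le> g a * prod g I"
    using p insert.prems(3)[of a] by (intro mult_right_mono) auto
  finally show ?case using insert by simp
qed simp

text \<open>
  The constant in the bound for the proportion of missed Gram matrices.  A new pivot costs at most
  $t(8/K + 2/q)$, and it turns the parameter $K$ of the remaining sets into $K/4$.
\<close>

primrec loss :: "nat \<Rightarrow> real" where
  "loss 0 = 0"
| "loss (Suc t) = 8 * real t + 4 * loss t"

lemma loss_nonneg: "0 \<le> loss t"
  by (induction t) auto

context finite_bilinear_space
begin

text \<open>
  The off-diagonal Gram matrices of the tuples in $E_1 \times \dots \times E_t$.  Different sets
  are needed for different vertices, because fixing a pivot restricts each of them to its own
  hyperplane.
\<close>

definition attained :: "nat \<Rightarrow> (nat \<Rightarrow> 'c set) \<Rightarrow> (nat \<times> nat \<Rightarrow> 'a) set" where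
  "attained t E = {l \<in> index_pairs t \<rightarrow>\<^sub>E carrier R.
     \<exists>a. (\<forall>i\<in>{1..t}. a i \<in> E i) \<and> (\<forall>(i, j)\<in>index_pairs t. B (a i) (a j) = l (i, j))}"

text \<open>
  The orthogonal projection to $x^\perp$ of the part of $S$ in the hyperplane $B(x,y) = c$.
\<close>

definition projected_slice :: "'c set \<Rightarrow> 'c \<Rightarrow> 'a \<Rightarrow> 'c set" where
  "projected_slice S x c =
     (\<lambda>y. y \<oplus>\<^bsub>M\<^esub> \<ominus>\<^bsub>M\<^esub> ((c \<otimes> inv (B x x)) \<odot>\<^bsub>M\<^esub> x)) ` slice S x c"

text \<open>
  The second condition keeps the radius of the projected set, $r - c^2/B(x,x)$, away from zero, so
  that the projected set again lies on a sphere of non-zero radius.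
\<close>

definition admissible_values :: "'c set \<Rightarrow> 'a \<Rightarrow> 'c \<Rightarrow> 'a set" where
  "admissible_values S r x = {c \<in> carrier R. c \<notin> thin_values S x \<and> c \<otimes> c \<noteq> r \<otimes> B x x}"

lemma projected_slice_subset:
  assumes V: "nondegenerate_subspace V" and S: "S \<subseteq> V" and x: "x \<in> V" "B x x \<noteq> \<zero>" and c: "c \<in> carrier R"
  shows "projected_slice S x c \<subseteq> slice V x \<zero>"
proof
  note D = nondegenerate_subspaceD[OF V]
  fix v assume "v \<in> projected_slice S x c"
  then obtain y where y: "y \<in> S" "B x y = c" "v = y \<oplus>\<^bsub>M\<^esub> \<ominus>\<^bsub>M\<^esub> ((c \<otimes> inv (B x x)) \<odot>\<^bsub>M\<^esub> x)"
    by (auto simp: projected_slice_def slice_def)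
  have yV: "y \<in> V" and yc: "y \<in> carrier M" and xc: "x \<in> carrier M" using y S D x by auto
  have U: "B x x \<in> Units R" using x xc by (simp add: field_Units)
  have "v \<in> V" using y(3) D(4,5,6) yV x c U by simp
  moreover have "B x v = \<zero>"
    using y(2,3) xc yc c U
    by (simp add: form_add_right form_minus_right form_smult_right R.m_assoc R.r_neg)
  ultimately show "v \<in> slice V x \<zero>" by (simp add: slice_def)
qed

lemma form_slice_eq_projected:
  assumes x: "x \<in> carrier M" "B x x \<noteq> \<zero>"
    and y: "y \<in> carrier M" "B x y = c" and z: "z \<in> carrier M" "B x z = e"
  shows "B (y \<oplus>\<^bsub>M\<^esub> \<ominus>\<^bsub>M\<^esub> ((c \<otimes> inv (B x x)) \<odot>\<^bsub>M\<^esub> x)) (z \<oplus>\<^bsub>M\<^esub> \<ominus>\<^bsub>M\<^esub> ((e \<otimes> inv (B x x)) \<odot>\<^bsub>M\<^esub> x))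
    = B y z \<ominus> c \<otimes> e \<otimes> inv (B x x)"
proof -
  have U: "B x x \<in> Units R" using x by (simp add: field_Units)
  have ce: "c \<in> carrier R" "e \<in> carrier R" using x y z by auto
  have i: "inv (B x x) \<in> carrier R" using U by simp
  define u where "u = z \<oplus>\<^bsub>M\<^esub> \<ominus>\<^bsub>M\<^esub> ((e \<otimes> inv (B x x)) \<odot>\<^bsub>M\<^esub> x)"
  have uc: "u \<in> carrier M" using x z ce i by (simp add: u_def)
  have xu: "B x u = \<zero>"
    using x z ce U by (simp add: u_def form_add_right form_minus_right form_smult_right R.m_assoc R.r_neg)
  have yx: "B y x = c" using x y form_sym by simp
  have "B (y \<oplus>\<^bsub>M\<^esub> \<ominus>\<^bsub>M\<^esub> ((c \<otimes> inv (B x x)) \<odot>\<^bsub>M\<^esub> x)) u = B y u"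
    using x y uc ce i xu by (simp add: form_add_left form_minus_left form_smult_left)
  also have "\<dots> = B y z \<ominus> e \<otimes> inv (B x x) \<otimes> c"
    using x y z ce i yx by (simp add: u_def form_add_right form_minus_right form_smult_right R.minus_eq)
  also have "e \<otimes> inv (B x x) \<otimes> c = c \<otimes> e \<otimes> inv (B x x)"
    using ce i by (simp add: R.m_ac)
  finally show ?thesis by (simp add: u_def)
qed

lemma card_projected_slice:
  assumes "S \<subseteq> carrier M" "x \<in> carrier M" "B x x \<noteq> \<zero>" "c \<in> carrier R"
  shows "card (projected_slice S x c) = card (slice S x c)"
  unfolding projected_slice_def
proof (rule card_image, rule inj_onI)
  have U: "B x x \<in> Units R" using assms by (simp add: field_Units)
  have w: "\<ominus>\<^bsub>M\<^esub> ((c \<otimes> inv (B x x)) \<odot>\<^bsub>M\<^esub> x) \<in> carrier M" using assms U by simp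
  fix y z assume "y \<in> slice S x c" "z \<in> slice S x c"
    and eq: "y \<oplus>\<^bsub>M\<^esub> \<ominus>\<^bsub>M\<^esub> ((c \<otimes> inv (B x x)) \<odot>\<^bsub>M\<^esub> x) = z \<oplus>\<^bsub>M\<^esub> \<ominus>\<^bsub>M\<^esub> ((c \<otimes> inv (B x x)) \<odot>\<^bsub>M\<^esub> x)"
  then have "y \<in> carrier M" "z \<in> carrier M" using assms by (auto simp: slice_def)
  then show "y = z" using eq w by simp
qed

lemma finite_attained: "finite (attained t E)"
  by (rule finite_subset[of _ "index_pairs t \<rightarrow>\<^sub>E carrier R"])
     (auto simp: attained_def finite_scalars intro: finite_PiE)

text \<open>
  With $x$ as the last vertex and $B(y_i,x) = \nu_i$, the Gram matrix of the $y_i$ differs from that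
  of their projections by the matrix $\nu_i\nu_j/B(x,x)$, which depends on $\nu$ only.  So a vector
  $\nu$ together with a Gram matrix of the projected slices determines, injectively, a Gram matrix
  on one more vertex.
\<close>

lemma sum_card_attained_le:
  assumes E: "\<And>i. i \<in> {1..t} \<Longrightarrow> E i \<subseteq> carrier M"
    and x: "x \<in> E (Suc t)" "x \<in> carrier M" "B x x \<noteq> \<zero>"
    and G: "\<And>i. i \<in> {1..t} \<Longrightarrow> G i \<subseteq> carrier R"
  shows "(\<Sum>\<nu>\<in>PiE {1..t} G. card (attained t (\<lambda>i. projected_slice (E i) x (\<nu> i)))) \<le> card (attained (Suc t) E)"
proof -
  have U: "B x x \<in> Units R" using x by (simp add: field_Units)
  have i: "inv (B x x) \<in> carrier R" using U by simp
  have fG: "finite (PiE {1..t} G)"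
    using G finite_scalars by (intro finite_PiE) (auto intro: finite_subset)
  let ?S = "SIGMA \<nu> : PiE {1..t} G. attained t (\<lambda>i. projected_slice (E i) x (\<nu> i))"
  define shift where "shift = (\<lambda>\<nu> (i::nat, j::nat). \<nu> i \<otimes> \<nu> j \<otimes> inv (B x x))"
  define f where "f = (\<lambda>(\<nu>, l). \<lambda>(i, j)\<in>index_pairs (Suc t).
      if j = Suc t then \<nu> i else l (i, j) \<oplus> shift \<nu> (i, j))"
  have nuc: "\<nu> i \<in> carrier R" if "\<nu> \<in> PiE {1..t} G" "1 \<le> i" "i \<le> t" for \<nu> i
    using that G[of i] by (auto simp: PiE_iff)
  have shc: "shift \<nu> (k, j) \<in> carrier R" if "\<nu> \<in> PiE {1..t} G" "(k, j) \<in> index_pairs t" for \<nu> k j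
    using that i nuc[of \<nu> k] nuc[of \<nu> j] by (auto simp: shift_def index_pairs_iff)
  have lc: "l (k, j) \<in> carrier R" if "l \<in> attained t E'" "(k, j) \<in> index_pairs t" for l k j E'
    using that by (auto simp: attained_def PiE_iff)
  have "inj_on f ?S"
  proof (rule inj_onI)
    fix p p' assume p: "p \<in> ?S" and p': "p' \<in> ?S" and eq: "f p = f p'"
    obtain \<nu> l \<nu>' l' where pq: "p = (\<nu>, l)" "p' = (\<nu>', l')" by (metis surj_pair)
    have n: "\<nu> \<in> PiE {1..t} G" "\<nu>' \<in> PiE {1..t} G"
      and l: "l \<in> attained t (\<lambda>i. projected_slice (E i) x (\<nu> i))"
        "l' \<in> attained t (\<lambda>i. projected_slice (E i) x (\<nu>' i))"
      using p p' pq by auto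
    have "\<nu> k = \<nu>' k" if "k \<in> {1..t}" for k
      using fun_cong[OF eq, of "(k, Suc t)"] that by (auto simp: f_def pq index_pairs_iff)
    then have nn: "\<nu> = \<nu>'" using n by (intro PiE_ext)
    have "l k = l' k" if k: "k \<in> index_pairs t" for k
    proof -
      obtain m j where mj: "k = (m, j)" by (cases k)
      have m: "(m, j) \<in> index_pairs (Suc t)" "j \<noteq> Suc t" using k by (auto simp: mj index_pairs_iff)
      have "l (m, j) \<oplus> shift \<nu> (m, j) = l' (m, j) \<oplus> shift \<nu> (m, j)"
        using fun_cong[OF eq, of "(m, j)"] m by (simp add: f_def pq nn)
      then show ?thesis
        using lc[OF l(1), of m j] lc[OF l(2), of m j] shc[OF n(1), of m j] k by (simp add: mj)
    qed
    then have "l = l'" using l unfolding attained_def by (intro PiE_ext[of l "index_pairs t" _ l']) auto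
    then show "p = p'" using nn pq by simp
  qed
  moreover have "f ` ?S \<subseteq> attained (Suc t) E"
  proof
    fix h assume "h \<in> f ` ?S"
    then obtain \<nu> l where h: "h = f (\<nu>, l)" and n: "\<nu> \<in> PiE {1..t} G"
      and l: "l \<in> attained t (\<lambda>i. projected_slice (E i) x (\<nu> i))" by auto
    let ?proj = "\<lambda>i y. y \<oplus>\<^bsub>M\<^esub> \<ominus>\<^bsub>M\<^esub> ((\<nu> i \<otimes> inv (B x x)) \<odot>\<^bsub>M\<^esub> x)"
    obtain a where a: "\<And>i. i \<in> {1..t} \<Longrightarrow> a i \<in> projected_slice (E i) x (\<nu> i)"
      and al: "\<And>i j. (i, j) \<in> index_pairs t \<Longrightarrow> B (a i) (a j) = l (i, j)"
      using l unfolding attained_def by fast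
    have "\<forall>i. \<exists>y. i \<in> {1..t} \<longrightarrow> y \<in> slice (E i) x (\<nu> i) \<and> a i = ?proj i y"
      using a unfolding projected_slice_def by blast
    then obtain y where y: "\<And>i. i \<in> {1..t} \<Longrightarrow> y i \<in> slice (E i) x (\<nu> i)"
      "\<And>i. i \<in> {1..t} \<Longrightarrow> a i = ?proj i (y i)" by metis
    define b where "b = y(Suc t := x)"
    have yE: "y i \<in> E i" "y i \<in> carrier M" "B x (y i) = \<nu> i" if "i \<in> {1..t}" for i
      using y(1)[OF that] E[OF that] by (auto simp: slice_def)
    have "h \<in> index_pairs (Suc t) \<rightarrow>\<^sub>E carrier R"
    proof (rule PiE_I)
      fix k assume k: "k \<in> index_pairs (Suc t)"
      obtain m j where mj: "k = (m, j)" by (cases k)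
      show "h k \<in> carrier R"
      proof (cases "j = Suc t")
        case True
        then show ?thesis using k nuc[OF n, of m] by (simp add: h f_def mj index_pairs_iff)
      next
        case False
        then have "(m, j) \<in> index_pairs t" using k by (auto simp: mj index_pairs_iff)
        then show ?thesis using k False lc[OF l] shc[OF n] by (simp add: h f_def mj)
      qed
    qed (simp add: h f_def)
    moreover have "\<forall>i\<in>{1..Suc t}. b i \<in> E i"
      using yE(1) x(1) by (auto simp: b_def le_Suc_eq)
    moreover have "B (b m) (b j) = h (m, j)" if k: "(m, j) \<in> index_pairs (Suc t)" for m j
    proof (cases "j = Suc t")
      case True
      then have m: "m \<in> {1..t}" "m \<noteq> Suc t" using k by (auto simp: index_pairs_iff)
      have "B (b m) (b j) = \<nu> m"
        using True m yE[OF m(1)] x form_sym[of x "y m"] by (simp add: b_def)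
      then show ?thesis using True k by (simp add: h f_def)
    next
      case False
      then have k': "(m, j) \<in> index_pairs t" using k by (auto simp: index_pairs_iff)
      then have m: "m \<in> {1..t}" "m \<noteq> Suc t" "j \<in> {1..t}" by (auto simp: index_pairs_iff)
      have "l (m, j) = B (?proj m (y m)) (?proj j (y j))"
        using al[OF k'] y(2) m by simp
      also have "\<dots> = B (y m) (y j) \<ominus> shift \<nu> (m, j)"
        using form_slice_eq_projected[OF x(2,3) yE(2,3)[OF m(1)] yE(2,3)[OF m(3)]]
        by (simp add: shift_def)
      finally have "l (m, j) = B (y m) (y j) \<ominus> shift \<nu> (m, j)" .
      then have "l (m, j) \<oplus> shift \<nu> (m, j) = B (y m) (y j)"
        using yE(2)[OF m(1)] yE(2)[OF m(3)] shc[OF n k']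
        by (simp add: R.minus_eq R.a_assoc R.l_neg)
      then show ?thesis using k False m by (simp add: h f_def b_def)
    qed
    ultimately show "h \<in> attained (Suc t) E"
      unfolding attained_def by blast
  qed
  ultimately have "card ?S \<le> card (attained (Suc t) E)"
    using finite_attained by (rule card_inj_on_le)
  then show ?thesis using fG by (simp add: card_SigmaI finite_attained)
qed

lemma card_admissible_values:
  assumes "r \<in> carrier R" "x \<in> carrier M"
  shows "real (card (admissible_values S r x)) \<ge> real q - real (card (thin_values S x)) - 2"
proof -
  let ?Z = "{c \<in> carrier R. c \<otimes> c = r \<otimes> B x x}"
  have "carrier R \<subseteq> admissible_values S r x \<union> (thin_values S x \<union> ?Z)"
    by (auto simp: admissible_values_def)
  then have "q \<le> card (admissible_values S r x \<union> (thin_values S x \<union> ?Z))"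
    by (rule card_mono[rotated]) (auto simp: admissible_values_def thin_values_def finite_scalars)
  also have "\<dots> \<le> card (admissible_values S r x) + (card (thin_values S x) + card ?Z)"
    by (intro order_trans[OF card_Un_le] add_left_mono card_Un_le)
  also have "card ?Z \<le> 2" using assms by (intro card_square_roots_le) simp
  finally have "q \<le> card (admissible_values S r x) + (card (thin_values S x) + 2)" by simp
  then show ?thesis by linarith
qed

text \<open>
  Averaging over $W$: some $x \in W$ has at most the average number of thin values.
\<close>

lemma ex_good_pivot:
  assumes V: "nondegenerate_subspace V" and W: "W \<subseteq> V" "W \<noteq> {}"
    and r: "r \<noteq> \<zero>" "\<And>x. x \<in> W \<Longrightarrow> B x x = r"
    and E: "\<And>i. i \<in> I \<Longrightarrow> E i \<subseteq> V" "\<And>i. i \<in> I \<Longrightarrow> E i \<noteq> {}" and I: "finite I"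
    and K: "K > 0" "\<And>i. i \<in> I \<Longrightarrow> K * real (card V) \<le> real (card (E i)) * real (card W)"
  obtains x where "x \<in> W" "(\<Sum>i\<in>I. real (card (thin_values (E i) x))) \<le> real (card I) * (8 * real q / K)"
proof -
  note D = nondegenerate_subspaceD[OF V]
  let ?b = "real (card I) * (8 * real q / K)"
  have fW: "finite W" using W D(2) finite_subset by blast
  then have w0: "real (card W) > 0" using W by (simp add: card_gt_0_iff)
  have "(\<Sum>x\<in>W. \<Sum>i\<in>I. real (card (thin_values (E i) x))) =
      (\<Sum>i\<in>I. \<Sum>x\<in>W. real (card (thin_values (E i) x)))"
    by (rule sum.swap)
  also have "\<dots> \<le> (\<Sum>i\<in>I. real (card W) * (8 * real q / K))"
  proof (rule sum_mono)
    fix i assume i: "i \<in> I"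
    have "finite (E i)" using E(1)[OF i] D(2) finite_subset by blast
    then have e0: "real (card (E i)) > 0" using E(2)[OF i] by (simp add: card_gt_0_iff)
    have "(\<Sum>x\<in>W. real (card (thin_values (E i) x))) \<le> 8 * real q * real (card V) / real (card (E i))"
      using sum_card_thin_values_le[OF V E(1)[OF i] E(2)[OF i] W(1) r] .
    also have "\<dots> = (8 * real q / (K * real (card (E i)))) * (K * real (card V))"
      using K(1) by simp
    also have "\<dots> \<le> (8 * real q / (K * real (card (E i)))) * (real (card (E i)) * real (card W))"
      using K(1) by (intro mult_left_mono K(2)[OF i]) auto
    also have "\<dots> = real (card W) * (8 * real q / K)"
      using e0 by simp
    finally show "(\<Sum>x\<in>W. real (card (thin_values (E i) x))) \<le> real (card W) * (8 * real q / K)" .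
  qed
  also have "\<dots> = (\<Sum>x\<in>W. ?b)" by simp
  finally have le: "(\<Sum>x\<in>W. \<Sum>i\<in>I. real (card (thin_values (E i) x))) \<le> (\<Sum>x\<in>W. ?b)" .
  have "\<exists>x\<in>W. (\<Sum>i\<in>I. real (card (thin_values (E i) x))) \<le> ?b"
  proof (rule ccontr)
    assume "\<not> ?thesis"
    then have "(\<Sum>x\<in>W. ?b) < (\<Sum>x\<in>W. \<Sum>i\<in>I. real (card (thin_values (E i) x)))"
      using fW W(2) by (intro sum_strict_mono) (auto simp: not_le)
    then show False using le by simp
  qed
  then show ?thesis using that by blast
qed

lemma card_slice_admissible:
  assumes "c \<in> admissible_values S r x"
  shows "real (card S) \<le> 2 * real q * real (card (slice S x c))"
proof -
  have "card S \<le> 2 * q * card (slice S x c)"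
    using assms by (auto simp: admissible_values_def thin_values_def)
  then have "real (card S) \<le> real (2 * q * card (slice S x c))" by (simp only: of_nat_le_iff)
  then show ?thesis by simp
qed

lemma card_PiE_admissible_values:
  assumes r: "\<And>i. i \<in> {1..t} \<Longrightarrow> r i \<in> carrier R" and x: "x \<in> carrier M"
    and thin: "(\<Sum>i=1..t. real (card (thin_values (E i) x))) \<le> b"
  shows "(1 - (b + 2 * real t) / real q) * real q ^ t
    \<le> real (card (PiE {1..t} (\<lambda>i. admissible_values (E i) (r i) x)))"
proof -
  let ?G = "\<lambda>i. admissible_values (E i) (r i) x"
  have q0: "real q > 0" using q_ge_2 by simp
  have "1 - (b + 2 * real t) / real q \<le> 1 - (\<Sum>i=1..t. (real (card (thin_values (E i) x)) + 2) / real q)"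
    using thin q0 by (simp add: sum.distrib sum_divide_distrib[symmetric] divide_right_mono)
  also have "\<dots> \<le> (\<Prod>i=1..t. real (card (?G i)) / real q)"
  proof (rule prod_ge_one_minus_sum)
    fix i assume i: "i \<in> {1..t}"
    have "card (?G i) \<le> q"
      by (rule card_mono) (auto simp: admissible_values_def finite_scalars)
    then show "real (card (?G i)) / real q \<le> 1" using q0 by simp
    show "1 - (real (card (thin_values (E i) x)) + 2) / real q \<le> real (card (?G i)) / real q"
    proof -
      have "real q - (real (card (thin_values (E i) x)) + 2) \<le> real (card (?G i))"
        using card_admissible_values[OF r[OF i] x, of "E i"] by linarith
      then have "(real q - (real (card (thin_values (E i) x)) + 2)) / real q \<le> real (card (?G i)) / real q"
        using q0 by (simp add: divide_right_mono)
      then show ?thesis using q0 by (simp add: diff_divide_distrib)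
    qed
  qed auto
  finally have "(1 - (b + 2 * real t) / real q) * real q ^ t \<le>
     (\<Prod>i=1..t. real (card (?G i)) / real q) * real q ^ t"
    by (rule mult_right_mono) simp
  also have "\<dots> = real (card (PiE {1..t} ?G))"
    using q0 by (simp add: prod_dividef card_PiE)
  finally show ?thesis .
qed

text \<open>
  Induction on the number of vertices.  A pivot $x \in E_{t+1}$ with few thin values is fixed; for
  most $\nu \in \mathbb{F}_q^t$ each $E_i$ then keeps at least $|E_i|/2q$ points in the hyperplane
  $B(x,y) = \nu_i$.  After projection to $x^\perp$ the hypothesis holds with $t$ in place of $t+1$,
  $|V|/q$ in place of $|V|$ and $K/4$ in place of $K$: both sides lose a factor $4q^2$, which is
  why the size condition has this form.
\<close>

theorem card_attained_ge:
  assumes "nondegenerate_subspace V" "K > 0"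
    and "\<And>i. i \<in> {1..t} \<Longrightarrow> E i \<subseteq> V"
    and "\<And>i. i \<in> {1..t} \<Longrightarrow> r i \<in> carrier R - {\<zero>}"
    and "\<And>i y. i \<in> {1..t} \<Longrightarrow> y \<in> E i \<Longrightarrow> B y y = r i"
    and "\<And>i j. i \<in> {1..t} \<Longrightarrow> j \<in> {1..t} \<Longrightarrow>
      K * real q ^ t * real (card V) \<le> real (card (E i)) * real (card (E j)) * (real q)\<^sup>2"
  shows "(1 - loss t * (1 / K + 1 / real q)) * real q ^ (t choose 2) \<le> real (card (attained t E))"
  using assms
proof (induction t arbitrary: V K E r)
  case 0
  have "attained 0 E = {\<lambda>_. undefined}" by (auto simp: attained_def)
  then show ?case by (simp add: binomial_eq_0)
next
  case (Suc t)
  note V = Suc.prems(1) and K = Suc.prems(2) and E = Suc.prems(3) and r = Suc.prems(4)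
    and Er = Suc.prems(5) and large = Suc.prems(6)
  note D = nondegenerate_subspaceD[OF V]
  have q0: "real q > 0" and q1: "real q \<ge> 1" using q_ge_2 by simp_all
  have V0: "real (card V) > 0" using D(2,3) by (auto simp: card_gt_0_iff)
  define W where "W = E (Suc t)"
  have E0: "E i \<noteq> {}" if "i \<in> {1..Suc t}" for i
  proof
    assume "E i = {}"
    then have "K * real q ^ Suc t * real (card V) \<le> 0" using large[OF that that] by simp
    moreover have "0 < K * real q ^ Suc t * real (card V)"
      using K q0 V0 by (intro mult_pos_pos zero_less_power)
    ultimately show False by linarith
  qed
  have WV: "W \<subseteq> V" and W0: "W \<noteq> {}" using E E0 by (auto simp: W_def)
  let ?\<rho> = "r (Suc t)"
  have \<rho>: "?\<rho> \<noteq> \<zero>" "\<And>x. x \<in> W \<Longrightarrow> B x x = ?\<rho>" using r Er by (auto simp: W_def)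
  \<comment> \<open>Here i exists, so there are at least two vertices and the power of q dominates its square.\<close>
  have KW: "K * real (card V) \<le> real (card (E i)) * real (card W)" if i: "i \<in> {1..t}" for i
  proof -
    have "K * real (card V) * (real q)\<^sup>2 \<le> K * real (card V) * real q ^ Suc t"
      using i K q1 by (intro mult_left_mono power_increasing) auto
    also have "\<dots> \<le> (real (card (E i)) * real (card W)) * (real q)\<^sup>2"
      using large[of i "Suc t"] i by (simp add: W_def mult_ac)
    finally show ?thesis using q0 by simp
  qed
  obtain x where x: "x \<in> W"
    and thin: "(\<Sum>i\<in>{1..t}. real (card (thin_values (E i) x))) \<le> real (card {1..t}) * (8 * real q / K)"
  proof (rule ex_good_pivot[OF V WV W0 \<rho>, where I = "{1..t}" and E = E and K = K])
    show "E i \<subseteq> V" "E i \<noteq> {}" if "i \<in> {1..t}" for i using that E[of i] E0[of i] by auto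
    show "K * real (card V) \<le> real (card (E i)) * real (card W)" if "i \<in> {1..t}" for i using KW that .
  qed (use K in auto)
  have xV: "x \<in> V" and xc: "x \<in> carrier M" and xx: "B x x = ?\<rho>" "B x x \<noteq> \<zero>"
    using x WV D(1) \<rho> by auto
  define G where "G = (\<lambda>i. admissible_values (E i) (r i) x)"
  define L where "L = (1 - loss t * (1 / (K / 4) + 1 / real q)) * real q ^ (t choose 2)"
  have x0: "x \<noteq> \<zero>\<^bsub>M\<^esub>"
    using xx(2) form_smult_right[of \<zero> x x] xc by auto
  have cardV: "real (card V) = real q * real (card (slice V x \<zero>))"
    using card_slice_subspace[OF V xV x0] by simp
  have L: "L \<le> real (card (attained t (\<lambda>i. projected_slice (E i) x (\<nu> i))))"
    if \<nu>: "\<nu> \<in> PiE {1..t} G" for \<nu>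
  proof -
    have \<nu>G: "\<nu> i \<in> G i" if "i \<in> {1..t}" for i using \<nu> that by (auto simp: PiE_iff)
    have \<nu>c: "\<nu> i \<in> carrier R" if "i \<in> {1..t}" for i
      using \<nu>G[OF that] by (simp add: G_def admissible_values_def)
    have U: "B x x \<in> Units R" using xx(2) form_closed[OF xc xc] by (simp add: field_Units)
    have ps: "card (projected_slice (E i) x (\<nu> i)) = card (slice (E i) x (\<nu> i))" if "i \<in> {1..t}" for i
      using that E D(1) xc xx \<nu>c[OF that] by (intro card_projected_slice) force+
    show ?thesis
      unfolding L_def
    proof (rule Suc.IH[of "slice V x \<zero>" "K / 4" _ "\<lambda>i. r i \<ominus> \<nu> i \<otimes> \<nu> i \<otimes> inv (B x x)"])
      show "nondegenerate_subspace (slice V x \<zero>)"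
        by (rule nondegenerate_orthogonal_complement[OF V xV xx(2)])
      show "0 < K / 4" using K by simp
    next
      fix i assume i: "i \<in> {1..t}"
      show "projected_slice (E i) x (\<nu> i) \<subseteq> slice V x \<zero>"
        using i E by (intro projected_slice_subset[OF V _ xV xx(2) \<nu>c[OF i]]) auto
      have ri: "r i \<in> carrier R" using r i by auto
      have "r i \<ominus> \<nu> i \<otimes> \<nu> i \<otimes> inv (B x x) \<noteq> \<zero>"
      proof
        assume "r i \<ominus> \<nu> i \<otimes> \<nu> i \<otimes> inv (B x x) = \<zero>"
        then have "r i = \<nu> i \<otimes> \<nu> i \<otimes> inv (B x x)" using ri \<nu>c[OF i] U by simp
        then have "r i \<otimes> B x x = \<nu> i \<otimes> \<nu> i" using \<nu>c[OF i] U by (simp add: R.m_assoc R.Units_closed)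
        then show False using \<nu>G[OF i] by (simp add: G_def admissible_values_def)
      qed
      then show "r i \<ominus> \<nu> i \<otimes> \<nu> i \<otimes> inv (B x x) \<in> carrier R - {\<zero>}"
        using ri \<nu>c[OF i] U by simp
      fix y assume "y \<in> projected_slice (E i) x (\<nu> i)"
      then obtain z where z: "z \<in> E i" "B x z = \<nu> i"
        "y = z \<oplus>\<^bsub>M\<^esub> \<ominus>\<^bsub>M\<^esub> ((\<nu> i \<otimes> inv (B x x)) \<odot>\<^bsub>M\<^esub> x)"
        by (auto simp: projected_slice_def slice_def)
      have zc: "z \<in> carrier M" using z(1) i E[of i] D(1) by auto
      show "B y y = r i \<ominus> \<nu> i \<otimes> \<nu> i \<otimes> inv (B x x)"
        using form_slice_eq_projected[OF xc xx(2) zc z(2) zc z(2)] z(3) Er[of i z] z(1) i by simp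
    next
      fix i j assume i: "i \<in> {1..t}" and j: "j \<in> {1..t}"
      let ?c = "\<lambda>i. real (card (slice (E i) x (\<nu> i)))"
      have "K * real q ^ Suc t * real (card V) \<le> real (card (E i)) * real (card (E j)) * (real q)\<^sup>2"
        using i j by (intro large) auto
      also have "\<dots> \<le> ((2 * real q * ?c i) * (2 * real q * ?c j)) * (real q)\<^sup>2"
        using \<nu>G[OF i] \<nu>G[OF j] unfolding G_def
        by (intro mult_right_mono mult_mono card_slice_admissible) auto
      finally have "(4 * (real q)\<^sup>2) * (K / 4 * real q ^ t * real (card (slice V x \<zero>)))
          \<le> (4 * (real q)\<^sup>2) * (?c i * ?c j * (real q)\<^sup>2)"
        unfolding cardV by (simp add: power2_eq_square mult_ac)
      then have "K / 4 * real q ^ t * real (card (slice V x \<zero>)) \<le> ?c i * ?c j * (real q)\<^sup>2"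
        using q0 by (subst (asm) mult_le_cancel_left_pos) auto
      then show "K / 4 * real q ^ t * real (card (slice V x \<zero>)) \<le>
          real (card (projected_slice (E i) x (\<nu> i))) * real (card (projected_slice (E j) x (\<nu> j))) * (real q)\<^sup>2"
        using ps[OF i] ps[OF j] by simp
    qed
  qed
  have G: "(1 - real t * (8 / K + 2 / real q)) * real q ^ t \<le> real (card (PiE {1..t} G))"
  proof -
    have "(1 - (real t * (8 * real q / K) + 2 * real t) / real q) * real q ^ t \<le> real (card (PiE {1..t} G))"
      unfolding G_def using thin r xc by (intro card_PiE_admissible_values) auto
    also have "(real t * (8 * real q / K) + 2 * real t) / real q = real t * (8 / K + 2 / real q)"
      using q0 K by (simp add: field_simps)
    finally show ?thesis .
  qed
  define \<beta> where "\<beta> = real t * (8 / K + 2 / real q)"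
  define u where "u = loss t * (4 / K + 1 / real q)"
  have \<beta>: "0 \<le> \<beta>" and u: "0 \<le> u" using K loss_nonneg[of t] by (simp_all add: \<beta>_def u_def)
  have tot: "\<beta> + u \<le> loss (Suc t) * (1 / K + 1 / real q)"
  proof -
    have "\<beta> + u \<le> real t * (8 / K + 8 / real q) + loss t * (4 / K + 4 / real q)"
      unfolding \<beta>_def u_def using loss_nonneg[of t] q0
      by (intro add_mono mult_left_mono) (auto simp: divide_right_mono)
    also have "\<dots> = loss (Suc t) * (1 / K + 1 / real q)" by (simp add: algebra_simps)
    finally show ?thesis .
  qed
  have Lu: "L = (1 - u) * real q ^ (t choose 2)" by (simp add: L_def u_def)
  show ?case
  \<comment> \<open>For u > 1 the factor L is negative and could not be multiplied with a lower bound, but then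
      the claim is trivial.\<close>
  proof (cases "u \<le> 1")
    case False
    then have "1 - loss (Suc t) * (1 / K + 1 / real q) \<le> 0" using tot \<beta> by linarith
    then have "(1 - loss (Suc t) * (1 / K + 1 / real q)) * real q ^ (Suc t choose 2) \<le> 0"
      by (simp add: mult_nonpos_nonneg)
    then show ?thesis by (rule order_trans) simp
  next
    case True
    have "(1 - loss (Suc t) * (1 / K + 1 / real q)) \<le> (1 - \<beta>) * (1 - u)"
      using tot mult_nonneg_nonneg[OF \<beta> u] by (simp add: algebra_simps)
    then have "(1 - loss (Suc t) * (1 / K + 1 / real q)) * real q ^ (Suc t choose 2)
        \<le> ((1 - \<beta>) * (1 - u)) * real q ^ (Suc t choose 2)"
      by (rule mult_right_mono) simp
    also have "\<dots> = ((1 - \<beta>) * real q ^ t) * L"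
      by (simp add: Lu numeral_2_eq_2 power_add mult_ac)
    also have "\<dots> \<le> real (card (PiE {1..t} G)) * L"
      using G True by (intro mult_right_mono) (auto simp: \<beta>_def Lu)
    also have "\<dots> = (\<Sum>\<nu>\<in>PiE {1..t} G. L)" by simp
    also have "\<dots> \<le> (\<Sum>\<nu>\<in>PiE {1..t} G. real (card (attained t (\<lambda>i. projected_slice (E i) x (\<nu> i)))))"
      by (rule sum_mono) (rule L)
    also have "\<dots> \<le> real (card (attained (Suc t) E))"
    proof -
      have "(\<Sum>\<nu>\<in>PiE {1..t} G. card (attained t (\<lambda>i. projected_slice (E i) x (\<nu> i)))) \<le> card (attained (Suc t) E)"
      proof (rule sum_card_attained_le)
        show "E i \<subseteq> carrier M" if "i \<in> {1..t}" for i using that E[of i] D(1) by auto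
        show "x \<in> E (Suc t)" using x by (simp add: W_def)
      qed (use xc xx in \<open>auto simp: G_def admissible_values_def\<close>)
      then have "real (\<Sum>\<nu>\<in>PiE {1..t} G. card (attained t (\<lambda>i. projected_slice (E i) x (\<nu> i))))
          \<le> real (card (attained (Suc t) E))" by (simp only: of_nat_le_iff)
      then show ?thesis by simp
    qed
    finally show ?thesis .
  qed
qed

end

section \<open>Quadratic forms in coordinates\<close>

text \<open>
  Module records extend ring records; their multiplication and unit are filled with constants.
\<close>

definition coord_module :: "('a, 'b) ring_scheme \<Rightarrow> nat \<Rightarrow> ('a, nat \<Rightarrow> 'a) module" where
  "coord_module F d =
     \<lparr>carrier = coord_space F d, monoid.mult = (\<lambda>_ _. vec_zero F d), one = vec_zero F d,
      ring.zero = vec_zero F d, ring.add = vec_add F d,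
      smult = (\<lambda>a x. \<lambda>k\<in>{..<d}. a \<otimes>\<^bsub>F\<^esub> x k)\<rparr>"

text \<open>
  The bilinear form of the coefficient matrix, symmetric or not; the quadratic form is its
  restriction to the diagonal and the polar form its symmetrisation.
\<close>

definition coefficient_form ::
    "('a, 'b) ring_scheme \<Rightarrow> nat \<Rightarrow> (nat \<Rightarrow> nat \<Rightarrow> 'a) \<Rightarrow> (nat \<Rightarrow> 'a) \<Rightarrow> (nat \<Rightarrow> 'a) \<Rightarrow> 'a" where
  "coefficient_form F d c x y =
     (\<Oplus>\<^bsub>F\<^esub>i\<in>{..<d}. \<Oplus>\<^bsub>F\<^esub>j\<in>{..<d}. c i j \<otimes>\<^bsub>F\<^esub> x i \<otimes>\<^bsub>F\<^esub> y j)"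

lemma coord_module_simps [simp]:
  "carrier (coord_module F d) = coord_space F d"
  "\<zero>\<^bsub>coord_module F d\<^esub> = vec_zero F d"
  "x \<oplus>\<^bsub>coord_module F d\<^esub> y = vec_add F d x y"
  "a \<odot>\<^bsub>coord_module F d\<^esub> x = (\<lambda>k\<in>{..<d}. a \<otimes>\<^bsub>F\<^esub> x k)"
  by (simp_all add: coord_module_def)

lemma coord_space_ext:
  assumes "x \<in> coord_space F d" "y \<in> coord_space F d" "\<And>k. k < d \<Longrightarrow> x k = y k"
  shows "x = y"
  using assms unfolding coord_space_def by (auto intro: PiE_ext)

context cring
begin

lemma coord_closed: "x \<in> coord_space R d \<Longrightarrow> k < d \<Longrightarrow> x k \<in> carrier R"
  by (auto simp: coord_space_def PiE_iff)

lemma vec_add_closed: "x \<in> coord_space R d \<Longrightarrow> y \<in> coord_space R d \<Longrightarrow> vec_add R d x y \<in> coord_space R d"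
  by (auto simp: coord_space_def vec_add_def PiE_iff)

lemma vec_smult_closed:
  "a \<in> carrier R \<Longrightarrow> x \<in> coord_space R d \<Longrightarrow> (\<lambda>k\<in>{..<d}. a \<otimes> x k) \<in> coord_space R d"
  by (auto simp: coord_space_def PiE_iff)

lemma vec_zero_closed: "vec_zero R d \<in> coord_space R d"
  by (auto simp: coord_space_def vec_zero_def PiE_iff)

lemma module_coord_module: "module R (coord_module R d)"
proof (rule moduleI)
  show "cring R" by (rule is_cring)
  show "abelian_group (coord_module R d)"
  proof (rule abelian_groupI)
    fix x y z
    assume x: "x \<in> carrier (coord_module R d)"
    show "\<zero>\<^bsub>coord_module R d\<^esub> \<oplus>\<^bsub>coord_module R d\<^esub> x = x"
    proof (rule coord_space_ext)
      show "\<zero>\<^bsub>coord_module R d\<^esub> \<oplus>\<^bsub>coord_module R d\<^esub> x \<in> coord_space R d"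
        using x by (simp add: vec_add_closed vec_zero_closed)
      show "x \<in> coord_space R d" using x by simp
    qed (use x in \<open>simp add: coord_closed vec_add_def vec_zero_def\<close>)
    have "(\<lambda>k\<in>{..<d}. \<ominus> x k) \<in> coord_space R d"
      using x by (auto simp: coord_space_def PiE_iff)
    moreover have "vec_add R d (\<lambda>k\<in>{..<d}. \<ominus> x k) x = vec_zero R d"
      using x by (auto simp: vec_add_def vec_zero_def coord_closed l_neg intro!: restrict_ext)
    ultimately show "\<exists>y\<in>carrier (coord_module R d). y \<oplus>\<^bsub>coord_module R d\<^esub> x = \<zero>\<^bsub>coord_module R d\<^esub>"
      by auto
    assume y: "y \<in> carrier (coord_module R d)"
    show "x \<oplus>\<^bsub>coord_module R d\<^esub> y \<in> carrier (coord_module R d)"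
      using x y by (simp add: vec_add_closed)
    show "x \<oplus>\<^bsub>coord_module R d\<^esub> y = y \<oplus>\<^bsub>coord_module R d\<^esub> x"
      using x y by (auto simp: vec_add_def coord_closed a_comm intro!: restrict_ext)
    assume z: "z \<in> carrier (coord_module R d)"
    show "x \<oplus>\<^bsub>coord_module R d\<^esub> y \<oplus>\<^bsub>coord_module R d\<^esub> z =
        x \<oplus>\<^bsub>coord_module R d\<^esub> (y \<oplus>\<^bsub>coord_module R d\<^esub> z)"
      using x y z by (auto simp: vec_add_def coord_closed a_assoc intro!: restrict_ext)
  qed (simp add: vec_zero_closed)
next
  fix x assume x: "x \<in> carrier (coord_module R d)"
  show "\<one> \<odot>\<^bsub>coord_module R d\<^esub> x = x"
    using x by (intro coord_space_ext[of _ R d]) (auto simp: vec_smult_closed coord_closed)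
qed (auto simp: vec_smult_closed vec_add_def coord_closed l_distr r_distr m_assoc intro!: restrict_ext)

lemma double_finsum_add:
  assumes "\<And>i j. i < d \<Longrightarrow> j < d \<Longrightarrow> f i j \<in> carrier R" "\<And>i j. i < d \<Longrightarrow> j < d \<Longrightarrow> g i j \<in> carrier R"
    and "\<And>i j. i < d \<Longrightarrow> j < d \<Longrightarrow> h i j = f i j \<oplus> g i j"
  shows "(\<Oplus>i\<in>{..<d}. \<Oplus>j\<in>{..<d}. h i j) =
    (\<Oplus>i\<in>{..<d}. \<Oplus>j\<in>{..<d::nat}. f i j) \<oplus> (\<Oplus>i\<in>{..<d}. \<Oplus>j\<in>{..<d}. g i j)"
proof -
  have "(\<Oplus>j\<in>{..<d}. h i j) = (\<Oplus>j\<in>{..<d}. f i j) \<oplus> (\<Oplus>j\<in>{..<d}. g i j)" if i: "i < d" for i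
  proof -
    have "(\<Oplus>j\<in>{..<d}. h i j) = (\<Oplus>j\<in>{..<d}. f i j \<oplus> g i j)"
      using assms i by (intro finsum_cong') auto
    also have "\<dots> = (\<Oplus>j\<in>{..<d}. f i j) \<oplus> (\<Oplus>j\<in>{..<d}. g i j)"
      using assms i by (intro finsum_addf) auto
    finally show ?thesis .
  qed
  then have "(\<Oplus>i\<in>{..<d}. \<Oplus>j\<in>{..<d}. h i j) =
      (\<Oplus>i\<in>{..<d}. (\<Oplus>j\<in>{..<d}. f i j) \<oplus> (\<Oplus>j\<in>{..<d}. g i j))"
    using assms by (intro finsum_cong') (auto intro!: finsum_closed)
  also have "\<dots> = (\<Oplus>i\<in>{..<d}. \<Oplus>j\<in>{..<d}. f i j) \<oplus> (\<Oplus>i\<in>{..<d}. \<Oplus>j\<in>{..<d}. g i j)"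
    using assms by (intro finsum_addf) (auto intro!: finsum_closed)
  finally show ?thesis .
qed

lemma double_finsum_mult:
  assumes "a \<in> carrier R" "\<And>i j. i < d \<Longrightarrow> j < d \<Longrightarrow> f i j \<in> carrier R"
    and "\<And>i j. i < d \<Longrightarrow> j < d \<Longrightarrow> h i j = a \<otimes> f i j"
  shows "(\<Oplus>i\<in>{..<d}. \<Oplus>j\<in>{..<d}. h i j) = a \<otimes> (\<Oplus>i\<in>{..<d}. \<Oplus>j\<in>{..<d::nat}. f i j)"
proof -
  have "(\<Oplus>j\<in>{..<d}. h i j) = a \<otimes> (\<Oplus>j\<in>{..<d}. f i j)" if i: "i < d" for i
  proof -
    have "(\<Oplus>j\<in>{..<d}. h i j) = (\<Oplus>j\<in>{..<d}. a \<otimes> f i j)"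
      using assms i by (intro finsum_cong') auto
    also have "\<dots> = a \<otimes> (\<Oplus>j\<in>{..<d}. f i j)"
      using assms i by (intro finsum_rdistr[symmetric]) auto
    finally show ?thesis .
  qed
  then have "(\<Oplus>i\<in>{..<d}. \<Oplus>j\<in>{..<d}. h i j) = (\<Oplus>i\<in>{..<d}. a \<otimes> (\<Oplus>j\<in>{..<d}. f i j))"
    using assms by (intro finsum_cong') (auto intro!: finsum_closed)
  also have "\<dots> = a \<otimes> (\<Oplus>i\<in>{..<d}. \<Oplus>j\<in>{..<d}. f i j)"
    using assms by (intro finsum_rdistr[symmetric]) (auto intro!: finsum_closed)
  finally show ?thesis .
qed

context
  fixes c :: "nat \<Rightarrow> nat \<Rightarrow> 'a" and d :: nat
  assumes c: "\<And>i j. i < d \<Longrightarrow> j < d \<Longrightarrow> c i j \<in> carrier R"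
begin

lemma coefficient_form_closed [simp]:
  "x \<in> coord_space R d \<Longrightarrow> y \<in> coord_space R d \<Longrightarrow> coefficient_form R d c x y \<in> carrier R"
  unfolding coefficient_form_def by (auto intro!: finsum_closed simp: c coord_closed)

lemma coefficient_form_add_left:
  "x \<in> coord_space R d \<Longrightarrow> y \<in> coord_space R d \<Longrightarrow> z \<in> coord_space R d \<Longrightarrow>
   coefficient_form R d c (vec_add R d x y) z = coefficient_form R d c x z \<oplus> coefficient_form R d c y z"
  unfolding coefficient_form_def
  by (rule double_finsum_add) (auto simp: c coord_closed vec_add_def l_distr r_distr)

lemma coefficient_form_add_right:
  "x \<in> coord_space R d \<Longrightarrow> y \<in> coord_space R d \<Longrightarrow> z \<in> coord_space R d \<Longrightarrow>
   coefficient_form R d c z (vec_add R d x y) = coefficient_form R d c z x \<oplus> coefficient_form R d c z y"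
  unfolding coefficient_form_def
  by (rule double_finsum_add) (auto simp: c coord_closed vec_add_def l_distr r_distr)

lemma coefficient_form_smult_left:
  "a \<in> carrier R \<Longrightarrow> x \<in> coord_space R d \<Longrightarrow> z \<in> coord_space R d \<Longrightarrow>
   coefficient_form R d c (\<lambda>k\<in>{..<d}. a \<otimes> x k) z = a \<otimes> coefficient_form R d c x z"
  unfolding coefficient_form_def
  by (rule double_finsum_mult) (auto simp: c coord_closed m_ac)

lemma coefficient_form_smult_right:
  "a \<in> carrier R \<Longrightarrow> x \<in> coord_space R d \<Longrightarrow> z \<in> coord_space R d \<Longrightarrow>
   coefficient_form R d c z (\<lambda>k\<in>{..<d}. a \<otimes> x k) = a \<otimes> coefficient_form R d c z x"
  unfolding coefficient_form_def
  by (rule double_finsum_mult) (auto simp: c coord_closed m_ac)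

lemma polar_form_eq:
  assumes Q: "\<And>x. x \<in> coord_space R d \<Longrightarrow> Q x = coefficient_form R d c x x"
    and x: "x \<in> coord_space R d" and y: "y \<in> coord_space R d"
  shows "polar_form R d Q x y = coefficient_form R d c x y \<oplus> coefficient_form R d c y x"
proof -
  let ?C = "coefficient_form R d c"
  have "Q (vec_add R d x y) = (?C x x \<oplus> ?C y x) \<oplus> (?C x y \<oplus> ?C y y)"
    using x y by (simp add: Q vec_add_closed coefficient_form_add_left coefficient_form_add_right)
  also have "\<dots> = (?C x y \<oplus> ?C y x) \<oplus> (?C x x \<oplus> ?C y y)"
    using x y by (simp add: a_ac)
  finally have *: "Q (vec_add R d x y) = (?C x y \<oplus> ?C y x) \<oplus> (?C x x \<oplus> ?C y y)" .
  have "u \<oplus> (v \<oplus> w) \<ominus> v \<ominus> w = u"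
    if "u \<in> carrier R" "v \<in> carrier R" "w \<in> carrier R" for u v w
  proof -
    have "u \<oplus> (v \<oplus> w) \<ominus> v \<ominus> w = u \<oplus> (w \<oplus> (v \<oplus> (\<ominus> v \<oplus> \<ominus> w)))"
      using that by (simp add: minus_eq a_assoc a_lcomm)
    then show ?thesis using that by (simp add: r_neg2 r_neg)
  qed
  then show ?thesis using x y unfolding polar_form_def * by (simp add: Q)
qed

lemma quadratic_form_vec_diff:
  assumes Q: "\<And>x. x \<in> coord_space R d \<Longrightarrow> Q x = coefficient_form R d c x x"
    and x: "x \<in> coord_space R d" and y: "y \<in> coord_space R d"
  shows "Q (vec_diff R d x y) = Q x \<oplus> Q y \<ominus> polar_form R d Q x y"
proof -
  let ?C = "coefficient_form R d c" and ?y = "\<lambda>k\<in>{..<d}. (\<ominus> \<one>) \<otimes> y k"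
  have y': "?y \<in> coord_space R d" using y by (intro vec_smult_closed) auto
  have d: "vec_diff R d x y = vec_add R d x ?y"
    using x y by (auto simp: vec_diff_def vec_add_def coord_closed l_minus minus_eq intro!: restrict_ext)
  have "Q (vec_diff R d x y) = (?C x x \<oplus> ?C ?y x) \<oplus> (?C x ?y \<oplus> ?C ?y ?y)"
    unfolding d using x y' by (simp add: Q vec_add_closed coefficient_form_add_left coefficient_form_add_right)
  also have "\<dots> = (?C x x \<oplus> \<ominus> ?C y x) \<oplus> (\<ominus> ?C x y \<oplus> ?C y y)"
    using x y y'
    by (simp only: coefficient_form_smult_left coefficient_form_smult_right a_inv_closed one_closed)
       (simp add: l_minus)
  also have "\<dots> = Q x \<oplus> Q y \<ominus> polar_form R d Q x y"
    using x y by (simp add: Q polar_form_eq[OF Q] minus_eq minus_add a_ac)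
  finally show ?thesis .
qed

lemma polar_form_same:
  assumes Q: "\<And>x. x \<in> coord_space R d \<Longrightarrow> Q x = coefficient_form R d c x x"
    and x: "x \<in> coord_space R d"
  shows "polar_form R d Q x x = Q x \<oplus> Q x"
  using x by (simp add: Q polar_form_eq[OF Q])

end

end

lemma finite_bilinear_space_polar_form:
  assumes F: "field F" "finite (carrier F)" and Q: "quadratic_form F d Q"
  shows "finite_bilinear_space F (coord_module F d) (polar_form F d Q)"
proof -
  interpret field F by (rule F)
  obtain c where c: "\<And>i j. i < d \<Longrightarrow> j < d \<Longrightarrow> c i j \<in> carrier F"
    and Qc: "\<And>x. x \<in> coord_space F d \<Longrightarrow> Q x = coefficient_form F d c x x"
    using Q unfolding quadratic_form_def coefficient_form_def by blast
  note pe = polar_form_eq[OF c Qc] and ac = a_ac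
  interpret module F "coord_module F d" by (rule module_coord_module)
  show ?thesis
  proof
    show "finite (carrier (coord_module F d))"
      using F(2) by (auto simp: coord_space_def intro: finite_PiE)
  qed (use F(2) c in \<open>auto simp: pe vec_add_closed vec_smult_closed coefficient_form_add_left
    coefficient_form_add_right coefficient_form_smult_left coefficient_form_smult_right r_distr
    ac\<close>)
qed

text \<open>
  If $2 = 0$, then $q = 2m+1$ equals $1$ in the field; but $q \cdot 1 = 0$ there by Lagrange's theorem.
\<close>

lemma (in field) two_not_zero_of_odd_order:
  assumes "finite (carrier R)" "odd (card (carrier R))"
  shows "\<one> \<oplus> \<one> \<noteq> \<zero>"
proof
  assume two: "\<one> \<oplus> \<one> = \<zero>"
  obtain m where m: "card (carrier R) = Suc (2 * m)" using assms(2) by (auto elim: oddE)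
  have "add_pow R (2 * m) \<one> = \<zero>"
    using two by (induction m) (simp_all add: a_assoc)
  moreover have "add_pow R (card (carrier R)) \<one> = \<zero>"
    using add.pow_order_eq_1[of \<one>] assms(1) by (simp add: order_def)
  ultimately show False by (simp add: m)
qed

section \<open>Solvable distance systems\<close>

text \<open>
  On the sphere, $Q(a-b) = 2 - B(a,b)$ for the polar form $B$, so a choice of $(\lambda_{ij})$ is
  solvable iff $(2-\lambda_{ij})$ is a Gram matrix; moreover $B(a,a) = 2 \neq 0$.  The size
  condition is the one of the Gram matrix bound with all sets equal and $|V| = q^d$.
\<close>

lemma card_solvable_choices_ge:
  assumes F: "field F" "finite (carrier F)" "odd (card (carrier F))"
    and Q: "nondegenerate_quadratic_form F d Q"
    and E: "E \<subseteq> Q_sphere F d Q"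
    and K: "K > 0" "K * real (card (carrier F)) ^ (d + t) \<le> (real (card E) * real (card (carrier F)))\<^sup>2"
  shows "(1 - loss t * (1 / K + 1 / real (card (carrier F)))) * real (card (carrier F)) ^ (t choose 2)
    \<le> real (card (solvable_choices F d t Q E))"
proof -
  have Qq: "quadratic_form F d Q" using Q by (simp add: nondegenerate_quadratic_form_def)
  interpret finite_bilinear_space F "coord_module F d" "polar_form F d Q"
    by (rule finite_bilinear_space_polar_form[OF F(1,2) Qq])
  obtain c where c: "\<And>i j. i < d \<Longrightarrow> j < d \<Longrightarrow> c i j \<in> carrier F"
    and Qc: "\<And>x. x \<in> coord_space F d \<Longrightarrow> Q x = coefficient_form F d c x x"
    using Qq unfolding quadratic_form_def coefficient_form_def by blast
  let ?two = "\<one>\<^bsub>F\<^esub> \<oplus>\<^bsub>F\<^esub> \<one>\<^bsub>F\<^esub>"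
  have E': "x \<in> coord_space F d" "Q x = \<one>\<^bsub>F\<^esub>" if "x \<in> E" for x
    using E that by (auto simp: Q_sphere_def)
  have V: "nondegenerate_subspace (coord_space F d)"
    unfolding nondegenerate_subspace_def
  proof (intro conjI ballI impI)
    show "submodule (coord_space F d) F (coord_module F d)"
      using carrier_is_submodule by simp
    fix z assume z: "z \<in> coord_space F d" "\<forall>u\<in>coord_space F d. polar_form F d Q u z = \<zero>\<^bsub>F\<^esub>"
    then have "\<forall>u\<in>coord_space F d. polar_form F d Q z u = \<zero>\<^bsub>F\<^esub>"
      using form_sym[of z] by simp
    then show "z = \<zero>\<^bsub>coord_module F d\<^esub>"
      using Q z(1) by (simp add: nondegenerate_quadratic_form_def)
  qed
  have "card (coord_space F d) = card (carrier F) ^ d"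
    by (simp add: coord_space_def card_PiE)
  then have "(1 - loss t * (1 / K + 1 / real (card (carrier F)))) * real (card (carrier F)) ^ (t choose 2)
      \<le> real (card (attained t (\<lambda>_. E)))"
    using E' K two_not_zero_of_odd_order[OF F(2,3)]
    by (intro card_attained_ge[OF V K(1), where r = "\<lambda>_. ?two"])
       (auto simp: polar_form_same[OF c Qc] power_add power2_eq_square mult_ac)
  also have "card (attained t (\<lambda>_. E)) \<le> card (solvable_choices F d t Q E)"
  proof (rule card_inj_on_le)
    let ?f = "\<lambda>l. \<lambda>p\<in>index_pairs t. ?two \<ominus>\<^bsub>F\<^esub> l p"
    show "finite (solvable_choices F d t Q E)"
      by (rule finite_subset[of _ "index_pairs t \<rightarrow>\<^sub>E carrier F"])
         (auto simp: solvable_choices_def F(2) intro: finite_PiE)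
    show "inj_on ?f (attained t (\<lambda>_. E))"
    proof (rule inj_onI)
      fix l l' assume l: "l \<in> attained t (\<lambda>_. E)" "l' \<in> attained t (\<lambda>_. E)" and eq: "?f l = ?f l'"
      have m: "l \<in> index_pairs t \<rightarrow>\<^sub>E carrier F" "l' \<in> index_pairs t \<rightarrow>\<^sub>E carrier F"
        using l by (auto simp: attained_def)
      have "l p = l' p" if p: "p \<in> index_pairs t" for p
      proof -
        have lp: "l p \<in> carrier F" "l' p \<in> carrier F" using m p by (auto simp: PiE_iff)
        have "?two \<ominus>\<^bsub>F\<^esub> l p = ?two \<ominus>\<^bsub>F\<^esub> l' p" using fun_cong[OF eq, of p] p by simp
        then have "\<ominus>\<^bsub>F\<^esub> l p = \<ominus>\<^bsub>F\<^esub> l' p" using lp by (simp add: R.minus_eq)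
        then show ?thesis using lp by (metis R.minus_minus)
      qed
      then show "l = l'" using m by (intro PiE_ext)
    qed
    show "?f ` attained t (\<lambda>_. E) \<subseteq> solvable_choices F d t Q E"
    proof
      fix h assume "h \<in> ?f ` attained t (\<lambda>_. E)"
      then obtain l where h: "h = ?f l" and l: "l \<in> attained t (\<lambda>_. E)" by blast
      obtain a where m: "l \<in> index_pairs t \<rightarrow>\<^sub>E carrier F" and a: "\<forall>i\<in>{1..t}. a i \<in> E"
        and al: "\<forall>(i, j)\<in>index_pairs t. polar_form F d Q (a i) (a j) = l (i, j)"
        using l unfolding attained_def by blast
      have "Q (vec_diff F d (a i) (a j)) = h (i, j)" if ij: "(i, j) \<in> index_pairs t" for i j
      proof -
        have "a i \<in> E" "a j \<in> E" using a ij by (auto simp: index_pairs_iff)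
        then show ?thesis
          using al ij E' by (auto simp: h quadratic_form_vec_diff[OF c Qc])
      qed
      moreover have "h \<in> index_pairs t \<rightarrow>\<^sub>E carrier F"
        using m by (auto simp: h PiE_iff)
      ultimately show "h \<in> solvable_choices F d t Q E"
        using a unfolding solvable_choices_def solvable_system_def by blast
    qed
  qed
  finally show ?thesis by simp
qed

lemma card_solvable_choices_le:
  assumes "finite (carrier F)"
  shows "card (solvable_choices F d t Q E) \<le> card (carrier F) ^ (t choose 2)"
proof -
  have "card (solvable_choices F d t Q E) \<le> card (index_pairs t \<rightarrow>\<^sub>E carrier F)"
    using assms by (intro card_mono) (auto simp: solvable_choices_def intro: finite_PiE)
  then show ?thesis by (simp add: card_PiE card_index_pairs)
qed

theorem theorem2p26:
  fixes F :: "nat \<Rightarrow> 'a ring"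
    and Q :: "nat \<Rightarrow> (nat \<Rightarrow> 'a) \<Rightarrow> 'a"
    and E :: "nat \<Rightarrow> (nat \<Rightarrow> 'a) set"
    and q :: "nat \<Rightarrow> nat"
    and d t :: nat
  assumes "d \<ge> 2" and "t \<ge> 2"
    and "\<And>n. field (F n)" and "\<And>n. finite (carrier (F n))"
    and "\<And>n. card (carrier (F n)) = q n"
    and "\<And>n. primepow (q n)" and "\<And>n. odd (q n)"
    and "filterlim q at_top sequentially"
    and "\<And>n. nondegenerate_quadratic_form (F n) d (Q n)"
    and "\<And>n. E n \<subseteq> Q_sphere (F n) d (Q n)"
    and "(\<lambda>n. real (q n) powr ((real d + real t - 2) / 2)) \<in> o(\<lambda>n. real (card (E n)))"
  shows "\<exists>\<delta>::nat \<Rightarrow> real. \<delta> \<in> o(\<lambda>n. 1) \<and>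
    (\<forall>n. real (card (solvable_choices (F n) d t (Q n) (E n))) \<ge>
           (1 - \<delta> n) * real (q n) ^ (t choose 2))"
proof -
  define s where "s = (real d + real t - 2) / 2"
  define S where "S n = real (card (solvable_choices (F n) d t (Q n) (E n)))" for n
  define \<delta> where "\<delta> n = 1 - S n / real (q n) ^ (t choose 2)" for n
  define \<rho> where "\<rho> n = real (q n) powr s / real (card (E n))" for n
  have q0: "real (q n) > 0" for n
    using assms(7)[of n] by (cases "q n") auto
  have small: "\<rho> \<longlonglongrightarrow> 0"
    using smalloD_tendsto[OF assms(11)] by (simp add: \<rho>_def[abs_def] s_def)
  have Epos: "eventually (\<lambda>n. real (card (E n)) > 0) sequentially"
  proof -
    have "eventually (\<lambda>n. norm (real (q n) powr s) \<le> 1 * norm (real (card (E n)))) sequentially"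
      using landau_o.smallD[OF assms(11), of 1] by (simp add: s_def)
    then show ?thesis
    proof eventually_elim
      case (elim n)
      have "0 < real (q n) powr s" using q0[of n] by simp
      moreover have "real (q n) powr s \<le> real (card (E n))" using elim by simp
      ultimately show ?case by linarith
    qed
  qed
  have lower: "0 \<le> \<delta> n" for n
  proof -
    have "card (solvable_choices (F n) d t (Q n) (E n)) \<le> q n ^ (t choose 2)"
      using card_solvable_choices_le[OF assms(4)[of n]] by (simp add: assms(5))
    then have "S n \<le> real (q n ^ (t choose 2))" unfolding S_def by (simp only: of_nat_le_iff)
    then show ?thesis using q0[of n] by (simp add: \<delta>_def)
  qed
  have upper: "eventually (\<lambda>n. \<delta> n \<le> loss t * ((\<rho> n)\<^sup>2 + 1 / real (q n))) sequentially"
    using Epos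
  proof eventually_elim
    case (elim n)
    have \<rho>: "\<rho> n > 0" using elim q0[of n] by (simp add: \<rho>_def)
    \<comment> \<open>The largest K that the size condition allows.\<close>
    define K where "K = 1 / (\<rho> n)\<^sup>2"
    have pw: "(real (q n) powr s)\<^sup>2 * (real (q n))\<^sup>2 = real (q n) ^ (d + t)"
    proof -
      have "(real (q n) powr s)\<^sup>2 * (real (q n))\<^sup>2 = real (q n) powr (2 * s) * real (q n) powr 2"
        using q0[of n] by (simp add: powr_power powr_numeral mult.commute)
      also have "\<dots> = real (q n) powr (2 * s + 2)" by (simp add: powr_add)
      also have "2 * s + 2 = real (d + t)" by (simp add: s_def field_simps)
      finally show ?thesis by (simp only: powr_realpow[OF q0])
    qed
    have "K * real (q n) ^ (d + t) = (real (card (E n)) * real (q n))\<^sup>2"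
      unfolding pw[symmetric] K_def \<rho>_def using elim q0[of n]
      by (simp add: power_divide power_mult_distrib)
    moreover have "K > 0" using \<rho> by (simp add: K_def)
    ultimately have "(1 - loss t * (1 / K + 1 / real (q n))) * real (q n) ^ (t choose 2) \<le> S n"
      using card_solvable_choices_ge[OF assms(3)[of n] assms(4)[of n] _ assms(9)[of n] assms(10)[of n], of K t]
        assms(7)[of n]
      by (simp add: assms(5) S_def)
    then have "1 - loss t * (1 / K + 1 / real (q n)) \<le> S n / real (q n) ^ (t choose 2)"
      using q0[of n] by (simp add: pos_le_divide_eq)
    then show ?case by (simp add: \<delta>_def K_def)
  qed
  have "(\<lambda>n. loss t * ((\<rho> n)\<^sup>2 + 1 / real (q n))) \<longlonglongrightarrow> loss t * (0\<^sup>2 + 0)"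
  proof (intro tendsto_intros small)
    have "filterlim (\<lambda>n. real (q n)) at_top sequentially"
      using filterlim_compose[OF filterlim_real_sequentially assms(8)] .
    then show "(\<lambda>n. 1 / real (q n)) \<longlonglongrightarrow> 0"
      by (intro tendsto_divide_0[OF tendsto_const] filterlim_at_top_imp_at_infinity)
  qed
  then have lim: "(\<lambda>n. loss t * ((\<rho> n)\<^sup>2 + 1 / real (q n))) \<longlonglongrightarrow> 0" by simp
  have "\<delta> \<longlonglongrightarrow> 0"
    by (rule tendsto_sandwich[OF _ upper tendsto_const lim]) (simp add: lower)
  then have "\<delta> \<in> o(\<lambda>n. 1)" by (intro smalloI_tendsto) auto
  moreover have "(1 - \<delta> n) * real (q n) ^ (t choose 2) \<le> S n" for n
    using q0[of n] by (simp add: \<delta>_def)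
  ultimately show ?thesis unfolding S_def by blast
qed

end
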